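(* Let $\mu$ be a non-negative Radon measure on $\mathbb{R}^d$ and let $f\in L^1_\mu(\mathbb{R}^d)$. Then $f\in W^{1,1}(\mathbb{R}^d,\mu)$ if and only if $\mathrm{TRS}(f)\ne\emptyset$. In this case, the function $|\nabla_\mu f|$ coincides with the $\mu$-a.e. minimal element of $\mathrm{TRS}(f)$.
   Context: $\mathrm{D}_\infty(\mathrm{div}_\mu)$ is the set of $v\in L^\infty_\mu(\mathbb{R}^d;\mathbb{R}^d)$ for which there exists $\mathrm{div}_\mu(v)\in L^\infty_\mu(\mathbb{R}^d)$ with $\int\nabla f\cdot v\,d\mu=-\int f\,\mathrm{div}_\mu(v)\,d\mu$ for all $f\in C^\infty_c(\mathbb{R}^d)$. A bundle in $\mathbb{R}^d$ is a map $V$ assigning to each $x$ a linear subspace $V(x)\subseteq\mathbb{R}^d$ with $x\mapsto\mathrm{dist}(y,V(x))$ Borel for every $y\in\mathbb{R}^d$. $T_\mu$ is the ($\mu$-a.e. unique) minimal bundle such that every $v\in\mathrm{D}_\infty(\mathrm{div}_\mu)$ satisfies $v(x)\in T_\mu(x)$ for $\mu$-a.e. $x$ (minimal: $T_\mu(x)\subseteq S(x)$ for $\mu$-a.e. $x$ for any other bundle $S$ with this property). $\Gamma^1_\mu(T_\mu)$ is the space of $v\in L^1_\mu(\mathbb{R}^d;\mathbb{R}^d)$ with $v(x)\in T_\mu(x)$ for $\mu$-a.e. $x$. For $f\in C^\infty_c(\mathbb{R}^d)$, $\nabla_\mu f(x):=\mathrm{pr}_{T_\mu(x)}(\nabla f(x))$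 (orthogonal projection). $W^{1,1}(\mathbb{R}^d,\mu)$ is the completion of $C^\infty_c(\mathbb{R}^d)$ under $\|f\|_{L^1_\mu}+\|\nabla_\mu f\|_{L^1_\mu}$; since $\nabla_\mu$ is closable, it is identified with the set of $f\in L^1_\mu(\mathbb{R}^d)$ for which there are $f_n\in C^\infty_c(\mathbb{R}^d)$ and $w\in\Gamma^1_\mu(T_\mu)$ with $f_n\to f$ in $L^1_\mu$ and $\nabla_\mu f_n\to w$ in $L^1_\mu(\mathbb{R}^d;\mathbb{R}^d)$; such $w$ is unique and is denoted $\nabla_\mu f$. Tangential relaxed slopes: $G\in L^1_\mu(\mathbb{R}^d)$ is a tangential relaxed slope of $f\in L^1_\mu(\mathbb{R}^d)$ if there are $(f_n)_n\subseteq C^\infty_c(\mathbb{R}^d)$ and $G'\in L^1_\mu(\mathbb{R}^d)$ with $f_n\to f$ in $L^1_\mu(\mathbb{R}^d)$, $|\nabla_\mu f_n|\rightharpoonup G'$ weakly in $L^1_\mu(\mathbb{R}^d)$, and $G'\le G$ $\mu$-a.e. $\mathrm{TRS}(f)$ is the set of all tangential relaxed slopes of $f$; when non-empty it has a unique $\mu$-a.e. minimal element, i.e. an element $G_f\in\mathrm{TRS}(f)$ with $G_f\le G$ $\mu$-a.e. for every $G\in\mathrm{TRS}(f)$. *)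

theory Defs
  imports "HOL-Analysis.Analysis"
begin

text \<open>
  The ambient space is an arbitrary Euclidean space \<open>'a\<close>, standing for the d-dimensional real space
  with \<open>d = DIM('a)\<close>. Elements of Lebesgue spaces are represented by Borel functions.
\<close>

text \<open>Borel measures on a Euclidean space that are finite on compact sets are automatically regular.\<close>

definition radon_measure :: "'a::euclidean_space measure \<Rightarrow> bool" where
  "radon_measure \<mu> \<longleftrightarrow> sets \<mu> = sets borel \<and> (\<forall>K. compact K \<longrightarrow> emeasure \<mu> K < \<infinity>)"

subsection \<open>Test functions and gradients\<close>

text \<open>A function is of class \<open>C (k+1)\<close> iff it is differentiable with all partial derivatives of
  class \<open>C k\<close>.\<close>

primrec C_k :: "nat \<Rightarrow> ('a::euclidean_space \<Rightarrow> real) \<Rightarrow> bool" where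
  "C_k 0 f \<longleftrightarrow> continuous_on UNIV f"
| "C_k (Suc k) f \<longleftrightarrow> (\<forall>x. f differentiable (at x)) \<and>
     (\<forall>b\<in>Basis. C_k k (\<lambda>x. frechet_derivative f (at x) b))"

definition test_functions :: "('a::euclidean_space \<Rightarrow> real) set" where
  "test_functions = {f. (\<forall>k. C_k k f) \<and> compact (closure {x. f x \<noteq> 0})}"

definition grad :: "('a::euclidean_space \<Rightarrow> real) \<Rightarrow> 'a \<Rightarrow> 'a" where
  "grad f x = (THE D. GDERIV f x :> D)"

lemma GDERIV_unique:
  fixes f :: "'a::euclidean_space \<Rightarrow> real"
  assumes "GDERIV f x :> D" "GDERIV f x :> D'"
  shows "D = D'"
proof -
  have "(\<lambda>h. inner h D) = (\<lambda>h. inner h D')"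
    using assms unfolding gderiv_def by (rule has_derivative_unique)
  then show ?thesis
    by (metis inner_commute vector_eq_ldot)
qed

lemma grad_eq: "GDERIV f x :> D \<Longrightarrow> grad f x = D"
  unfolding grad_def by (blast intro: the_equality GDERIV_unique)

lemma GDERIV_grad:
  fixes f :: "'a::euclidean_space \<Rightarrow> real"
  assumes "f differentiable (at x)"
  shows "GDERIV f x :> grad f x"
proof -
  obtain f' where f': "(f has_derivative f') (at x)"
    using assms unfolding differentiable_def by blast
  then have "f' = (\<lambda>h. inner h (adjoint f' 1))"
    using adjoint_works[OF has_derivative_linear[OF f'], of _ 1] by (auto simp: fun_eq_iff)
  with f' have "GDERIV f x :> adjoint f' 1"
    unfolding gderiv_def by simp
  then show ?thesis
    using grad_eq by metis
qed

subsection \<open>Lebesgue spaces\<close>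

definition L1 :: "'a measure \<Rightarrow> ('a \<Rightarrow> 'b::{banach, second_countable_topology}) set" where
  "L1 \<mu> = {f. integrable \<mu> f}"

definition Linfty :: "'a measure \<Rightarrow> ('a \<Rightarrow> 'b::{banach, second_countable_topology}) set" where
  "Linfty \<mu> = {f \<in> borel_measurable \<mu>. \<exists>C. AE x in \<mu>. norm (f x) \<le> C}"

definition L1_tendsto ::
    "'a measure \<Rightarrow> (nat \<Rightarrow> 'a \<Rightarrow> 'b::{banach, second_countable_topology}) \<Rightarrow> ('a \<Rightarrow> 'b) \<Rightarrow> bool" where
  "L1_tendsto \<mu> fs f \<longleftrightarrow> (\<forall>n. fs n \<in> L1 \<mu>) \<and> f \<in> L1 \<mu> \<and>
     (\<lambda>n. \<integral>x. norm (fs n x - f x) \<partial>\<mu>) \<longlonglongrightarrow> 0"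

text \<open>Weak convergence in \<open>L1\<close> is tested against \<open>Linfty\<close>, the dual space, as Radon measures on
  Euclidean spaces are sigma-finite.\<close>

definition L1_weak_tendsto :: "'a measure \<Rightarrow> (nat \<Rightarrow> 'a \<Rightarrow> real) \<Rightarrow> ('a \<Rightarrow> real) \<Rightarrow> bool" where
  "L1_weak_tendsto \<mu> gs g \<longleftrightarrow> (\<forall>n. gs n \<in> L1 \<mu>) \<and> g \<in> L1 \<mu> \<and>
     (\<forall>h\<in>Linfty \<mu>. (\<lambda>n. \<integral>x. gs n x * h x \<partial>\<mu>) \<longlonglongrightarrow> (\<integral>x. g x * h x \<partial>\<mu>))"

subsection \<open>The tangent bundle of a measure\<close>

definition D_inf_div :: "'a::euclidean_space measure \<Rightarrow> ('a \<Rightarrow> 'a) set" where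
  "D_inf_div \<mu> = {v \<in> Linfty \<mu>. \<exists>g\<in>Linfty \<mu>. \<forall>f\<in>test_functions.
     (\<integral>x. inner (grad f x) (v x) \<partial>\<mu>) = - (\<integral>x. f x * g x \<partial>\<mu>)}"

definition is_bundle :: "('a::euclidean_space \<Rightarrow> 'a set) \<Rightarrow> bool" where
  "is_bundle V \<longleftrightarrow> (\<forall>x. subspace (V x)) \<and>
     (\<forall>y. (\<lambda>x. infdist y (V x)) \<in> borel_measurable borel)"

definition carries_D_inf_div ::
    "'a::euclidean_space measure \<Rightarrow> ('a \<Rightarrow> 'a set) \<Rightarrow> bool" where
  "carries_D_inf_div \<mu> V \<longleftrightarrow> (\<forall>v\<in>D_inf_div \<mu>. AE x in \<mu>. v x \<in> V x)"

text \<open>The tangent bundle is unique only up to null sets, so it is described by a predicate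
  satisfied by exactly its representatives.\<close>

definition is_tangent_bundle ::
    "'a::euclidean_space measure \<Rightarrow> ('a \<Rightarrow> 'a set) \<Rightarrow> bool" where
  "is_tangent_bundle \<mu> T \<longleftrightarrow> is_bundle T \<and> carries_D_inf_div \<mu> T \<and>
     (\<forall>S. is_bundle S \<and> carries_D_inf_div \<mu> S \<longrightarrow> (AE x in \<mu>. T x \<subseteq> S x))"

definition Gamma1 ::
    "'a::euclidean_space measure \<Rightarrow> ('a \<Rightarrow> 'a set) \<Rightarrow> ('a \<Rightarrow> 'a) set" where
  "Gamma1 \<mu> T = {v \<in> L1 \<mu>. AE x in \<mu>. v x \<in> T x}"

subsection \<open>Tangential gradients and the Sobolev space\<close>

definition orth_proj :: "'a::euclidean_space set \<Rightarrow> 'a \<Rightarrow> 'a" where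
  "orth_proj V x = (THE y. y \<in> V \<and> (\<forall>z\<in>V. orthogonal (x - y) z))"

lemma orth_proj:
  fixes V :: "'a::euclidean_space set"
  assumes V: "subspace V"
  shows "orth_proj V x \<in> V \<and> (\<forall>z\<in>V. orthogonal (x - orth_proj V x) z)"
proof -
  obtain y z where "y \<in> span V" "\<And>w. w \<in> span V \<Longrightarrow> orthogonal z w" "x = y + z"
    using orthogonal_subspace_decomp_exists by metis
  then have y: "y \<in> V \<and> (\<forall>w\<in>V. orthogonal (x - y) w)"
    using V by (auto simp: span_eq_iff[THEN iffD2])
  have "y' = y" if y': "y' \<in> V \<and> (\<forall>w\<in>V. orthogonal (x - y') w)" for y'
  proof -
    have "y' - y \<in> V"
      using V y y' by (blast intro: subspace_diff)
    then have "inner (x - y) (y' - y) = 0" "inner (x - y') (y' - y) = 0"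
      using y y' by (auto simp: orthogonal_def)
    then have "inner (y' - y) (y' - y) = 0"
      by (simp add: inner_diff_left)
    then show ?thesis by simp
  qed
  with y show ?thesis
    unfolding orth_proj_def by (rule theI)
qed

definition tan_grad ::
    "('a::euclidean_space \<Rightarrow> 'a set) \<Rightarrow> ('a \<Rightarrow> real) \<Rightarrow> 'a \<Rightarrow> 'a" where
  "tan_grad T f x = orth_proj (T x) (grad f x)"

text \<open>\<open>w\<close> represents the tangential gradient of the Sobolev function \<open>f\<close>.\<close>

definition is_sobolev_grad ::
    "'a::euclidean_space measure \<Rightarrow> ('a \<Rightarrow> 'a set) \<Rightarrow> ('a \<Rightarrow> real) \<Rightarrow> ('a \<Rightarrow> 'a) \<Rightarrow> bool" where
  "is_sobolev_grad \<mu> T f w \<longleftrightarrow> w \<in> Gamma1 \<mu> T \<and>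
     (\<exists>fs. (\<forall>n. fs n \<in> test_functions) \<and> L1_tendsto \<mu> fs f \<and>
        L1_tendsto \<mu> (\<lambda>n. tan_grad T (fs n)) w)"

definition W11 ::
    "'a::euclidean_space measure \<Rightarrow> ('a \<Rightarrow> 'a set) \<Rightarrow> ('a \<Rightarrow> real) set" where
  "W11 \<mu> T = {f \<in> L1 \<mu>. \<exists>w. is_sobolev_grad \<mu> T f w}"

subsection \<open>Tangential relaxed slopes\<close>

definition TRS ::
    "'a::euclidean_space measure \<Rightarrow> ('a \<Rightarrow> 'a set) \<Rightarrow> ('a \<Rightarrow> real) \<Rightarrow> ('a \<Rightarrow> real) set" where
  "TRS \<mu> T f = {G \<in> L1 \<mu>. \<exists>fs. \<exists>G'\<in>L1 \<mu>. (\<forall>n. fs n \<in> test_functions) \<and> L1_tendsto \<mu> fs f \<and>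
     L1_weak_tendsto \<mu> (\<lambda>n x. norm (tan_grad T (fs n) x)) G' \<and> (AE x in \<mu>. G' x \<le> G x)}"

definition is_minimal_TRS ::
    "'a::euclidean_space measure \<Rightarrow> ('a \<Rightarrow> 'a set) \<Rightarrow> ('a \<Rightarrow> real) \<Rightarrow> ('a \<Rightarrow> real) \<Rightarrow> bool" where
  "is_minimal_TRS \<mu> T f G \<longleftrightarrow> G \<in> TRS \<mu> T f \<and> (\<forall>H\<in>TRS \<mu> T f. AE x in \<mu>. G x \<le> H x)"

end

theory Submission
  imports Defs
begin

text \<open>
  Mazur's lemma and the Dunford--Pettis theorem are replaced by a direct argument. Weak convergence
  of the non-negative functions \<open>|\<nabla>\<^sub>\<mu> f\<^sub>n|\<close> forces their uniform integrability, by testing against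
  decreasing unions of the sets where they are large. Hence the strictly convex functional
  \<open>u \<mapsto> \<integral> sqrt (r\<^sup>2 + |u|\<^sup>2) d\<mu>\<close>, for a positive integrable weight \<open>r\<close>, is bounded on the iterated
  midpoints of the tails of \<open>\<nabla>\<^sub>\<mu> f\<^sub>n\<close>, and near-minimizers on these shrinking sets are Cauchy in
  \<open>L1\<close>. The limit \<open>w\<close> is a tangential gradient of \<open>f\<close>, and \<open>|w|\<close> lies below the weak limit by
  convexity of the norm. Minimality then follows from uniqueness of the gradient: the difference
  \<open>z\<close> of two gradients of \<open>f\<close> is orthogonal to every field in \<open>D_inf_div \<mu>\<close>, so minimality of the
  tangent bundle gives \<open>T x \<subseteq> z(x)\<^sup>\<bottom>\<close> almost everywhere, while \<open>z\<close> is itself tangent.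
\<close>

subsection \<open>Smooth functions with compact support\<close>

lemma C_k_D:
  assumes "C_k (Suc k) f"
  shows "f differentiable (at x)" "b \<in> Basis \<Longrightarrow> C_k k (\<lambda>x. frechet_derivative f (at x) b)"
  using assms by auto

lemma C_k_imp_continuous: "C_k k f \<Longrightarrow> continuous_on UNIV f"
  by (cases k) (auto intro!: differentiable_imp_continuous_within continuous_at_imp_continuous_on)

lemma C_k_Suc_imp: "C_k (Suc k) f \<Longrightarrow> C_k k f"
proof (induction k arbitrary: f)
  case 0
  then show ?case
    using C_k_imp_continuous[of "Suc 0" f] by simp
next
  case (Suc k)
  then show ?case
    using C_k_D[OF Suc.prems] C_k.simps(2)[of k f] by blast
qed

lemma frechet_derivative_eqI:
  assumes "(f has_derivative f') (at x)"
  shows "frechet_derivative f (at x) = f'"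
  using frechet_derivative_at[OF assms] by simp

lemma C_k_SucI:
  assumes "\<And>x. (f has_derivative f' x) (at x)" "\<And>b. b \<in> Basis \<Longrightarrow> C_k k (\<lambda>x. f' x b)"
  shows "C_k (Suc k) f"
  using assms by (auto simp: frechet_derivative_eqI[OF assms(1)] differentiable_def)

lemma C_k_Suc_has_derivative:
  "C_k (Suc k) f \<Longrightarrow> (f has_derivative frechet_derivative f (at x)) (at x)"
  using C_k_D(1) frechet_derivative_works by blast

lemma C_k_const: "C_k k (\<lambda>x. c)"
proof (induction k arbitrary: c)
  case (Suc k)
  show ?case
    by (rule C_k_SucI[where f' = "\<lambda>_ _. 0"]) (use Suc in auto)
qed simp

lemma C_k_add: "C_k k f \<Longrightarrow> C_k k g \<Longrightarrow> C_k k (\<lambda>x. f x + g x)"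
proof (induction k arbitrary: f g)
  case (Suc k)
  show ?case
    by (rule C_k_SucI, rule has_derivative_add)
      (use Suc C_k_Suc_has_derivative C_k_D(2) in blast)+
qed (simp add: continuous_on_add)

lemma C_k_mult: "C_k k f \<Longrightarrow> C_k k g \<Longrightarrow> C_k k (\<lambda>x. f x * g x)"
proof (induction k arbitrary: f g)
  case (Suc k)
  have "C_k k (\<lambda>x. f x * frechet_derivative g (at x) b + frechet_derivative f (at x) b * g x)"
    if "b \<in> Basis" for b
    using Suc C_k_D(2)[OF _ that] C_k_Suc_imp by (intro C_k_add Suc.IH) blast+
  moreover have "((\<lambda>x. f x * g x) has_derivative
      (\<lambda>h. f x * frechet_derivative g (at x) h + frechet_derivative f (at x) h * g x)) (at x)" for x
    by (intro has_derivative_mult C_k_Suc_has_derivative[of k] Suc.prems)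
  ultimately show ?case
    by (intro C_k_SucI)
qed (simp add: continuous_on_mult)

lemma C_k_prod:
  assumes "finite A" "\<And>i. i \<in> A \<Longrightarrow> C_k k (f i)"
  shows "C_k k (\<lambda>x. \<Prod>i\<in>A. f i x)"
  using assms by (induction A) (auto intro: C_k_mult C_k_const)

section \<open>The flat function exp(-1/t) and its derivatives\<close>

definition exp_inv :: "real poly \<Rightarrow> real \<Rightarrow> real" where
  "exp_inv p t = (if t > 0 then poly p (1 / t) * exp (- (1 / t)) else 0)"

lemma poly_exp_minus_tendsto_0: "((\<lambda>s::real. poly p s * exp (- s)) \<longlongrightarrow> 0) at_top"
proof -
  have "((\<lambda>s. \<Sum>i\<le>degree p. coeff p i * (s ^ i / exp s)) \<longlongrightarrow> (\<Sum>i\<le>degree p. coeff p i * 0)) at_top"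
    by (intro tendsto_sum tendsto_mult tendsto_const tendsto_power_div_exp_0)
  moreover have "(\<Sum>i\<le>degree p. coeff p i * (s ^ i / exp s)) = poly p s * exp (- s)" for s
    by (simp add: poly_altdef sum_distrib_right exp_minus divide_inverse mult.assoc)
  ultimately show ?thesis by simp
qed

lemma exp_inv_tendsto_0: "(exp_inv p \<longlongrightarrow> 0) (at 0)"
proof -
  have "((\<lambda>t. poly p (1 / t) * exp (- (1 / t))) \<longlongrightarrow> 0) (at_right 0)"
    using filterlim_compose[OF poly_exp_minus_tendsto_0[of p] filterlim_inverse_at_top_right]
    by (simp add: inverse_eq_divide)
  then have "(exp_inv p \<longlongrightarrow> 0) (at_right 0)"
    by (rule Lim_transform_eventually)
      (auto simp: exp_inv_def eventually_at_filter)
  moreover have "(exp_inv p \<longlongrightarrow> 0) (at_left 0)"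
    by (rule tendsto_eventually) (auto simp: exp_inv_def eventually_at_filter)
  ultimately show ?thesis
    by (rule filterlim_split_at[rotated])
qed

text \<open>With s = 1/t one has d/dt = -s^2 d/ds, which turns p(s) exp(-s) into s^2 (p - p')(s)
  exp(-s). The polynomial parameter is carried along so that the family is closed under
  differentiation.\<close>

lemma exp_inv_has_derivative:
  "(exp_inv p has_real_derivative exp_inv (monom 1 2 * (p - pderiv p)) t) (at t)"
proof -
  let ?q = "monom 1 2 * (p - pderiv p)"
  consider "t > 0" | "t < 0" | "t = 0" by linarith
  then show ?thesis
  proof cases
    case 1
    have "((\<lambda>t. poly p (1 / t) * exp (- (1 / t))) has_real_derivative exp_inv ?q t) (at t)"
      using 1
      by (auto intro!: derivative_eq_intros poly_DERIV[THEN DERIV_chain2]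
        simp: exp_inv_def poly_monom field_simps power2_eq_square)
    then show ?thesis
      by (rule has_field_derivative_transform_within[where d = "t"])
        (use 1 in \<open>auto simp: exp_inv_def dist_real_def\<close>)
  next
    case 2
    have "((\<lambda>t. 0) has_real_derivative exp_inv ?q t) (at t)"
      using 2 by (auto simp: exp_inv_def)
    then show ?thesis
      by (rule has_field_derivative_transform_within[where d = "-t"])
        (use 2 in \<open>auto simp: exp_inv_def dist_real_def\<close>)
  next
    case 3
    \<comment> \<open>Dividing by \<open>h\<close> multiplies the polynomial in 1/h by its variable,
      so the difference quotient at 0 is again in the family and tends to 0.\<close>
    have "exp_inv p h / h = exp_inv (pCons 0 p) h" for h
      by (simp add: exp_inv_def field_simps)
    moreover have "exp_inv q 0 = 0" for q
      by (simp add: exp_inv_def)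
    ultimately show ?thesis
      using 3 exp_inv_tendsto_0[of "pCons 0 p"] by (simp add: DERIV_def)
  qed
qed

text \<open>The induction on \<open>k\<close> has to run over all \<open>p\<close> at once, since
  differentiating changes the polynomial.\<close>

lemma C_k_exp_inv: "C_k k (\<lambda>x. exp_inv p (s * (inner x b) + c))"
proof (induction k arbitrary: p)
  case 0
  have "continuous_on UNIV (exp_inv p)"
    using exp_inv_has_derivative DERIV_isCont continuous_at_imp_continuous_on by blast
  then have "continuous_on UNIV (exp_inv p \<circ> (\<lambda>x. s * (inner x b) + c))"
    by (intro continuous_on_compose continuous_intros) (auto intro: continuous_on_subset)
  then show ?case by (simp add: o_def)
next
  case (Suc k)
  let ?q = "monom 1 2 * (p - pderiv p)"
  have "((\<lambda>x. exp_inv p (s * (inner x b) + c)) has_derivative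
     (\<lambda>h. (s * inner h b) * exp_inv ?q (s * (inner x b) + c))) (at x)" for x
    by (rule derivative_eq_intros exp_inv_has_derivative[THEN DERIV_compose_FDERIV])+ auto
  then show ?case
    by (rule C_k_SucI) (intro C_k_mult C_k_const Suc)
qed

lemma exp_inv_1_bounds: "0 \<le> exp_inv 1 t" "exp_inv 1 t \<le> 1"
  by (auto simp: exp_inv_def)

text \<open>For t > 0 the value is exp(-1/(n t)), which tends to 1. The half-line in the limit is
  open because \<open>exp_inv\<close> vanishes at 0; hence the limits of products are indicators of
  open boxes.\<close>

lemma exp_inv_1_tendsto: "(\<lambda>n. exp_inv 1 (real n * t)) \<longlonglongrightarrow> indicator {0<..} t"
proof (cases "t > 0")
  case True
  have "(\<lambda>n. exp (- (1 / t) * inverse (real n))) \<longlonglongrightarrow> exp (- (1 / t) * 0)"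
    by (intro tendsto_intros lim_inverse_n)
  then have "(\<lambda>n. exp (- (1 / t) * inverse (real n))) \<longlonglongrightarrow> indicator {0<..} t"
    using True by simp
  then show ?thesis
    by (rule Lim_transform_eventually, intro eventually_sequentiallyI[of 1])
      (use True in \<open>auto simp: exp_inv_def field_simps\<close>)
qed (auto simp: exp_inv_def mult_le_0_iff zero_less_mult_iff)

section \<open>Closure properties of test functions\<close>

lemma test_functions_D:
  assumes "f \<in> test_functions"
  shows "C_k k f" "f differentiable (at x)" "continuous_on UNIV f"
    "GDERIV f x :> grad f x" "compact (closure {x. f x \<noteq> 0})"
proof -
  show C: "C_k k f" for k
    using assms by (auto simp: test_functions_def)
  show "compact (closure {x. f x \<noteq> 0})"
    using assms by (auto simp: test_functions_def)
  show "f differentiable (at x)" "continuous_on UNIV f"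
    using C[of 1] C[of 0] by auto
  then show "GDERIV f x :> grad f x"
    by (intro GDERIV_grad)
qed

lemma compact_closure_mono:
  fixes A B :: "'a::heine_borel set"
  shows "compact (closure B) \<Longrightarrow> A \<subseteq> B \<Longrightarrow> compact (closure A)"
  by (metis bounded_subset compact_closure)

lemma test_functions_add:
  assumes "f \<in> test_functions" "g \<in> test_functions"
  shows "(\<lambda>x. f x + g x) \<in> test_functions"
proof -
  have "compact (closure ({x. f x \<noteq> 0} \<union> {x. g x \<noteq> 0}))"
    unfolding closure_Un by (intro compact_Un test_functions_D assms)
  then have "compact (closure {x. f x + g x \<noteq> 0})"
    by (rule compact_closure_mono) auto
  then show ?thesis
    using assms by (auto simp: test_functions_def intro: C_k_add)
qed

lemma test_functions_mult:
  assumes "f \<in> test_functions" "\<And>k. C_k k g"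
  shows "(\<lambda>x. f x * g x) \<in> test_functions"
  using assms compact_closure_mono[of "{x. f x \<noteq> 0}" "{x. f x * g x \<noteq> 0}"]
  by (auto simp: test_functions_def intro: C_k_mult)

lemma test_functions_scale: "f \<in> test_functions \<Longrightarrow> (\<lambda>x. c * f x) \<in> test_functions"
  using test_functions_mult[OF _ C_k_const, of f c] by (simp add: mult.commute)

section \<open>Smooth approximation of indicators of open boxes\<close>

definition bump :: "'a::euclidean_space \<Rightarrow> 'a \<Rightarrow> nat \<Rightarrow> 'a \<Rightarrow> real" where
  "bump a b n x = (\<Prod>i\<in>Basis. exp_inv 1 (real n * (x \<bullet> i - a \<bullet> i)) * exp_inv 1 (real n * (b \<bullet> i - x \<bullet> i)))"

text \<open>Each factor vanishes off an open half-space bounding the box, so the support stays in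
  the closure of the bounded box for every \<open>n\<close>; the index only steepens the
  edges.\<close>

lemma bump_test_functions: "bump a b n \<in> test_functions"
proof -
  have "C_k k (\<lambda>x. exp_inv 1 (real n * (x \<bullet> i) + (- real n * (a \<bullet> i)))
      * exp_inv 1 (- real n * (x \<bullet> i) + real n * (b \<bullet> i)))" for k and i :: 'a
    by (intro C_k_mult C_k_exp_inv)
  then have "C_k k (bump a b n)" for k
    unfolding bump_def by (intro C_k_prod) (auto simp: algebra_simps)
  moreover have "{x. bump a b n x \<noteq> 0} \<subseteq> box a b"
    by (auto simp: bump_def exp_inv_def box_def zero_less_mult_iff split: if_splits)
  then have "compact (closure {x. bump a b n x \<noteq> 0})"
    using bounded_box bounded_subset compact_closure by blast
  ultimately show ?thesis
    by (auto simp: test_functions_def)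
qed

lemma bump_bounds: "0 \<le> bump a b n x" "bump a b n x \<le> 1"
  unfolding bump_def
  by (auto intro!: prod_nonneg prod_le_1 mult_le_one simp: exp_inv_1_bounds)

lemma bump_tendsto: "(\<lambda>n. bump a b n x) \<longlonglongrightarrow> indicator (box a b) x"
proof -
  have "(\<lambda>n. bump a b n x) \<longlonglongrightarrow>
     (\<Prod>i\<in>Basis. indicator {0<..} (x \<bullet> i - a \<bullet> i) * indicator {0<..} (b \<bullet> i - x \<bullet> i))"
    unfolding bump_def by (intro tendsto_prod tendsto_mult exp_inv_1_tendsto)
  also have "(\<Prod>i\<in>Basis. indicator {0<..} (x \<bullet> i - a \<bullet> i) * indicator {0<..} (b \<bullet> i - x \<bullet> i))
     = (indicator (box a b) x :: real)"
  proof (cases "x \<in> box a b")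
    case False
    then obtain i where "i \<in> Basis" "\<not> (a \<bullet> i < x \<bullet> i \<and> x \<bullet> i < b \<bullet> i)"
      by (auto simp: box_def)
    then show ?thesis
      using False by (auto intro!: prod_zero bexI[of _ i])
  qed (auto simp: box_def intro!: prod.neutral)
  finally show ?thesis .
qed

section \<open>Gradients of test functions\<close>

lemma frechet_derivative_eq_inner_grad:
  assumes "f differentiable (at x)"
  shows "frechet_derivative f (at x) b = inner b (grad f x)"
  using GDERIV_grad[OF assms] by (simp add: gderiv_def frechet_derivative_eqI)

lemma continuous_on_grad:
  assumes "f \<in> test_functions"
  shows "continuous_on UNIV (grad f)"
proof -
  have "continuous_on UNIV (\<lambda>x. grad f x \<bullet> b)" if "b \<in> Basis" for b
    using C_k_D(2)[OF test_functions_D(1)[OF assms, of "Suc 0"] that]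
    by (simp add: frechet_derivative_eq_inner_grad[OF test_functions_D(2)[OF assms]] inner_commute)
  then show ?thesis
    by (subst continuous_on_componentwise) blast
qed

lemma compact_support_grad:
  assumes "f \<in> test_functions"
  shows "compact (closure {x. grad f x \<noteq> 0})"
proof -
  have "grad f x = 0" if "x \<notin> closure {x. f x \<noteq> 0}" for x
  proof -
    have o: "open (- closure {x. f x \<noteq> 0})" "x \<in> - closure {x. f x \<noteq> 0}"
      using that by auto
    have 0: "f y = 0" if "y \<in> - closure {x. f x \<noteq> 0}" for y
      using that closure_subset[of "{x. f x \<noteq> 0}"] by blast
    have "(f has_derivative (\<lambda>h. 0)) (at x)"
      by (rule has_derivative_transform_within_open[OF has_derivative_const[of 0] o]) (rule 0[symmetric])
    then show ?thesis
      by (intro grad_eq) (simp add: gderiv_def)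
  qed
  then have "{x. grad f x \<noteq> 0} \<subseteq> closure {x. f x \<noteq> 0}"
    by blast
  then show ?thesis
    using test_functions_D(5)[OF assms] compact_closure_mono
    by (metis closure_closure)
qed

lemma grad_add:
  assumes "f \<in> test_functions" "g \<in> test_functions"
  shows "grad (\<lambda>x. f x + g x) x = grad f x + grad g x"
  by (intro grad_eq GDERIV_add test_functions_D assms)

lemma grad_mult:
  assumes "f \<in> test_functions" "g \<in> test_functions"
  shows "grad (\<lambda>x. f x * g x) x = f x *\<^sub>R grad g x + g x *\<^sub>R grad f x"
  by (intro grad_eq GDERIV_mult test_functions_D assms)

lemma grad_scale:
  assumes "f \<in> test_functions"
  shows "grad (\<lambda>x. c * f x) x = c *\<^sub>R grad f x"
  using GDERIV_mult[OF GDERIV_const test_functions_D(4)[OF assms], of c] by (intro grad_eq) simp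

subsection \<open>Integration against Radon measures\<close>

text \<open>Open boxes are stable under intersection and generate the Borel sets, so a Dynkin
  induction extends the vanishing of the integrals from boxes to all Borel sets.\<close>

lemma AE_eq_0_if_box_integrals:
  fixes h :: "'a::euclidean_space \<Rightarrow> real"
  assumes sets: "sets \<mu> = sets borel" and h: "integrable \<mu> h"
    and box: "\<And>a b. (\<integral>x. indicator (box a b) x * h x \<partial>\<mu>) = 0"
  shows "AE x in \<mu>. h x = 0"
proof -
  have [measurable_cong]: "sets \<mu> = sets borel" by (rule sets)
  have space: "space \<mu> = UNIV" using sets_eq_imp_space_eq[OF sets] by simp
  have int: "integrable \<mu> (\<lambda>x. indicator A x * h x)" if "A \<in> sets borel" for A
    using integrable_mult_indicator[OF _ h, of A] that sets by simp
  \<comment> \<open>The complement step of the induction subtracts from the integral over the whole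
    space, which therefore has to vanish first. Growing boxes exhaust the space.\<close>
  have UNIV0: "(\<integral>x. h x \<partial>\<mu>) = 0"
  proof -
    have "(\<lambda>n. \<integral>x. indicator (box (- real n *\<^sub>R One) (real n *\<^sub>R One)) x * h x \<partial>\<mu>)
        \<longlonglongrightarrow> (\<integral>x. h x \<partial>\<mu>)"
    proof (rule integral_dominated_convergence[where w = "\<lambda>x. norm (h x)"])
      have "(\<lambda>n. indicator (box (- real n *\<^sub>R One) (real n *\<^sub>R One)) x * h x) \<longlonglongrightarrow> h x" for x
      proof -
        obtain N :: nat where N: "norm x < real N"
          using reals_Archimedean2 by blast
        have "x \<in> box (- real n *\<^sub>R One) (real n *\<^sub>R One)" if "n \<ge> N" for n
        proof -
          have "\<bar>x \<bullet> i\<bar> < real n" if "i \<in> Basis" for i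
            using Basis_le_norm[OF that, of x] N \<open>n \<ge> N\<close> by linarith
          then show ?thesis
            by (force simp: box_def abs_less_iff)
        qed
        then show ?thesis
          by (intro tendsto_eventually eventually_sequentiallyI[of N]) auto
      qed
      then show "AE x in \<mu>. (\<lambda>n. indicator (box (- real n *\<^sub>R One) (real n *\<^sub>R One)) x * h x) \<longlonglongrightarrow> h x"
        by auto
    qed (use h in \<open>auto split: split_indicator\<close>)
    then show ?thesis
      by (simp add: box LIMSEQ_const_iff)
  qed
  have "(\<integral>x. indicator A x * h x \<partial>\<mu>) = 0" if "A \<in> sets borel" for A
  proof -
    have "Int_stable (range (\<lambda>(a, b). box a b :: 'a set))"
      by (auto simp: Int_stable_def box_Int_box)
    moreover have "range (\<lambda>(a, b). box a b :: 'a set) \<subseteq> Pow UNIV"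
      by auto
    moreover have "A \<in> sigma_sets UNIV (range (\<lambda>(a, b). box a b))"
      using that unfolding borel_eq_box by simp
    ultimately show ?thesis
    proof (induction rule: sigma_sets_induct_disjoint)
      case (basic A)
      then show ?case using box by auto
    next
      case (compl A)
      then have A: "A \<in> sets borel" by (simp add: borel_eq_box)
      have "(\<integral>x. indicator (UNIV - A) x * h x \<partial>\<mu>) = (\<integral>x. h x - indicator A x * h x \<partial>\<mu>)"
        by (intro Bochner_Integration.integral_cong) (auto split: split_indicator)
      also have "\<dots> = 0"
        using compl.IH UNIV0 by (simp add: int[OF A] h)
      finally show ?case .
    next
      case (union A)
      then have A: "A i \<in> sets \<mu>" for i by (auto simp: borel_eq_box sets)
      have "(\<integral>x\<in>(\<Union>i. A i). h x \<partial>\<mu>) = (\<Sum>i. \<integral>x\<in>A i. h x \<partial>\<mu>)"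
      proof (rule lebesgue_integral_countable_add[OF A])
        show "A i \<inter> A j = {}" if "i \<noteq> j" for i j
          using \<open>disjoint_family A\<close> that by (simp add: disjoint_family_on_def)
        show "set_integrable \<mu> (\<Union>i. A i) h"
          using int[of "\<Union>i. A i"] A by (auto simp: set_integrable_def sets)
      qed
      then show ?case
        using union by (simp add: set_lebesgue_integral_def)
    qed simp
  qed
  then show ?thesis
    by (intro density_unique_real h) (auto simp: set_lebesgue_integral_def sets)
qed

locale radon =
  fixes \<mu> :: "'a::euclidean_space measure"
  assumes radon: "radon_measure \<mu>"
begin

lemma sets_eq [measurable_cong, simp]: "sets \<mu> = sets borel"
  using radon by (simp add: radon_measure_def)

lemma space_eq [simp]: "space \<mu> = UNIV"
  using sets_eq_imp_space_eq[OF sets_eq] by simp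

lemma measurable_eq [simp]: "measurable \<mu> M = measurable borel M"
  by (intro measurable_cong_sets) simp_all

text \<open>Closed balls are compact, hence of finite measure. Sigma-finiteness later supplies the
  positive integrable weight \<open>r\<close>.\<close>

sublocale sigma_finite_measure \<mu>
proof
  show "\<exists>A. countable A \<and> A \<subseteq> sets \<mu> \<and> \<Union> A = space \<mu> \<and> (\<forall>a\<in>A. emeasure \<mu> a \<noteq> \<infinity>)"
  proof (intro exI[of _ "range (\<lambda>n. cball 0 (real n))"] conjI ballI)
    show "\<Union> (range (\<lambda>n. cball (0::'a) (real n))) = space \<mu>"
      by (auto intro: real_arch_simple)
    show "emeasure \<mu> a \<noteq> \<infinity>" if "a \<in> range (\<lambda>n. cball 0 (real n))" for a
      using that radon compact_cball unfolding radon_measure_def by (metis imageE less_irrefl)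
  qed auto
qed

lemma integrable_compact_support:
  fixes f :: "'a \<Rightarrow> 'b::{banach, second_countable_topology}"
  assumes f: "continuous_on UNIV f" and K: "compact (closure {x. f x \<noteq> 0})"
  shows "integrable \<mu> f" "\<exists>C. \<forall>x. norm (f x) \<le> C"
proof -
  let ?K = "closure {x. f x \<noteq> 0}"
  have "compact (f ` ?K)"
    using f K continuous_on_subset by (intro compact_continuous_image) auto
  then obtain C where C: "\<And>x. x \<in> ?K \<Longrightarrow> norm (f x) \<le> C"
    using compact_imp_bounded bounded_iff by (metis imageI)
  have 0: "f x = 0" if "x \<notin> ?K" for x
    using that closure_subset[of "{x. f x \<noteq> 0}"] by blast
  show "integrable \<mu> f"
  proof (rule integrableI_bounded_set[of ?K])
    show "f \<in> borel_measurable \<mu>"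
      using f by (simp add: borel_measurable_continuous_onI)
    show "emeasure \<mu> ?K < \<infinity>"
      using radon K by (simp add: radon_measure_def)
    show "AE x in \<mu>. x \<in> ?K \<longrightarrow> norm (f x) \<le> C" "AE x in \<mu>. x \<notin> ?K \<longrightarrow> f x = 0"
      using C 0 by blast+
  qed simp
  have "norm (f x) \<le> \<bar>C\<bar>" for x
    using C[of x] 0[of x] by (cases "x \<in> ?K") auto
  then show "\<exists>C. \<forall>x. norm (f x) \<le> C" by blast
qed

text \<open>This is the fundamental lemma of the calculus of variations: the functions
  \<open>bump a b n\<close> lie between 0 and 1 and converge to the indicator of the box, so
  dominated convergence reduces the claim to box integrals.\<close>

lemma AE_eq_0_if_test_functions:
  assumes h: "integrable \<mu> h"
    and 0: "\<And>\<phi>. \<phi> \<in> test_functions \<Longrightarrow> (\<integral>x. \<phi> x * h x \<partial>\<mu>) = 0"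
  shows "AE x in \<mu>. h x = 0"
proof (rule AE_eq_0_if_box_integrals[OF sets_eq h])
  fix a b :: 'a
  have "(\<lambda>n. \<integral>x. bump a b n x * h x \<partial>\<mu>) \<longlonglongrightarrow> (\<integral>x. indicator (box a b) x * h x \<partial>\<mu>)"
  proof (rule integral_dominated_convergence[where w = "\<lambda>x. norm (h x)"])
    show "(\<lambda>x. bump a b n x * h x) \<in> borel_measurable \<mu>" for n
      using borel_measurable_continuous_onI[OF test_functions_D(3)[OF bump_test_functions[of a b n]]]
        borel_measurable_integrable[OF h] by simp
    show "AE x in \<mu>. norm (bump a b n x * h x) \<le> norm (h x)" for n
      using bump_bounds[of a b n] by (auto simp: abs_mult mult_left_le_one_le)
  qed (use h in \<open>auto intro!: tendsto_mult bump_tendsto\<close>)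
  then show "(\<integral>x. indicator (box a b) x * h x \<partial>\<mu>) = 0"
    by (simp add: 0 bump_test_functions LIMSEQ_const_iff)
qed

end

subsection \<open>Orthogonal projections and bundles\<close>

context
  fixes V :: "'a::euclidean_space set"
  assumes V: "subspace V"
begin

lemma orth_proj_mem: "orth_proj V x \<in> V"
  and orth_proj_inner: "z \<in> V \<Longrightarrow> inner (orth_proj V x) z = inner x z"
  using orth_proj[OF V, of x] by (auto simp: orthogonal_def inner_diff_left)

lemma orth_proj_eqI:
  assumes "y \<in> V" "\<And>z. z \<in> V \<Longrightarrow> inner y z = inner x z"
  shows "orth_proj V x = y"
proof -
  have "orth_proj V x - y \<in> V"
    using V assms(1) orth_proj_mem by (intro subspace_diff)
  then have "inner (orth_proj V x - y) (orth_proj V x - y) = 0"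
    using assms orth_proj_inner by (simp add: inner_diff_left)
  then show ?thesis by simp
qed

lemma linear_orth_proj: "linear (orth_proj V)"
  by (rule linearI)
    (auto intro!: orth_proj_eqI subspace_add subspace_scale V orth_proj_mem
      simp: inner_add_left orth_proj_inner)

lemma norm_orth_proj_le: "norm (orth_proj V x) \<le> norm x"
proof -
  have "norm (orth_proj V x) * norm (orth_proj V x) = inner x (orth_proj V x)"
    using orth_proj_inner[OF orth_proj_mem] by (metis norm_eq_square power2_eq_square power2_norm_eq_inner)
  also have "\<dots> \<le> norm x * norm (orth_proj V x)"
    by (rule norm_cauchy_schwarz)
  finally show ?thesis
    by (cases "orth_proj V x = 0") auto
qed

lemma infdist_subspace: "infdist x V = norm (x - orth_proj V x)"
proof (rule antisym)
  show "infdist x V \<le> norm (x - orth_proj V x)"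
    using infdist_le[OF orth_proj_mem, of x x] by (simp add: dist_norm)
  have "norm (x - orth_proj V x) \<le> dist x z" if "z \<in> V" for z
  proof -
    have "orth_proj V x - z \<in> V"
      using V that orth_proj_mem by (intro subspace_diff)
    then have "orthogonal (x - orth_proj V x) (orth_proj V x - z)"
      using orth_proj[OF V] by blast
    then have "(norm (x - orth_proj V x + (orth_proj V x - z)))\<^sup>2
        = (norm (x - orth_proj V x))\<^sup>2 + (norm (orth_proj V x - z))\<^sup>2"
      by (rule norm_add_Pythagorean)
    then have "(norm (x - orth_proj V x))\<^sup>2 \<le> (dist x z)\<^sup>2"
      by (simp add: dist_norm)
    then show ?thesis
      by (rule power2_le_imp_le) simp
  qed
  then show "norm (x - orth_proj V x) \<le> infdist x V"
    using subspace_0[OF V] unfolding infdist_def by (auto intro: cINF_greatest)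
qed

lemma norm_orth_proj_sq: "(norm (orth_proj V x))\<^sup>2 = (norm x)\<^sup>2 - (infdist x V)\<^sup>2"
proof -
  have "orthogonal (x - orth_proj V x) (orth_proj V x)"
    using orth_proj[OF V] by blast
  then have "(norm (x - orth_proj V x + orth_proj V x))\<^sup>2
      = (norm (x - orth_proj V x))\<^sup>2 + (norm (orth_proj V x))\<^sup>2"
    by (rule norm_add_Pythagorean)
  then show ?thesis by (simp add: infdist_subspace)
qed

text \<open>\<open>is_bundle\<close> gives measurability of distances only. By
  \<open>norm_orth_proj_sq\<close> distances determine the norms of projections, and polarization
  recovers from these the entries of the projection matrix.\<close>

lemma inner_orth_proj_polar:
  "inner (orth_proj V x) y = ((norm (orth_proj V (x + y)))\<^sup>2 - (norm (orth_proj V (x - y)))\<^sup>2) / 4"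
proof -
  have "inner (orth_proj V x) y = inner (orth_proj V x) (orth_proj V y)"
    using orth_proj_inner[OF orth_proj_mem, of y x] by (simp add: inner_commute)
  then show ?thesis
    by (simp add: linear_add[OF linear_orth_proj] linear_diff[OF linear_orth_proj]
        power2_norm_eq_inner inner_add_left inner_add_right inner_diff_left inner_diff_right inner_commute)
qed

end

text \<open>The explicit distance makes the orthogonal complement of a measurable field a bundle. A
  field may vanish at some points; there the complement is the whole space and the distance is
  0.\<close>

lemma infdist_hyperplane:
  fixes w :: "'a::euclidean_space"
  shows "infdist y {z. inner w z = 0} = (if w = 0 then 0 else \<bar>inner w y\<bar> / norm w)"
proof -
  have V: "subspace {z. inner w z = 0}"
    by (rule subspace_hyperplane)
  have "orth_proj {z. inner w z = 0} y = y - (inner w y / inner w w) *\<^sub>R w"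
    by (rule orth_proj_eqI[OF V]) (auto simp: inner_diff_right inner_diff_left)
  then have "infdist y {z. inner w z = 0} = norm ((inner w y / inner w w) *\<^sub>R w)"
    by (simp add: infdist_subspace[OF V])
  also have "\<dots> = (if w = 0 then 0 else \<bar>inner w y\<bar> / norm w)"
    by (auto simp: abs_divide power2_norm_eq_inner[symmetric] power2_eq_square)
  finally show ?thesis .
qed

lemma is_bundle_hyperplane:
  assumes [measurable]: "w \<in> borel_measurable borel"
  shows "is_bundle (\<lambda>x. {z. inner (w x) z = 0})"
  unfolding is_bundle_def infdist_hyperplane
  by (auto intro: subspace_hyperplane)

text \<open>Linearity reduces a measurable \<open>u\<close> to constant basis vectors, for which
  polarization gives measurable coordinates of the projection.\<close>

lemma borel_measurable_orth_proj:
  assumes T: "is_bundle T" and u[measurable]: "u \<in> borel_measurable borel"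
  shows "(\<lambda>x. orth_proj (T x) (u x)) \<in> borel_measurable borel"
proof -
  have sub: "subspace (T x)" for x
    using T by (simp add: is_bundle_def)
  have [measurable]: "(\<lambda>x. infdist y (T x)) \<in> borel_measurable borel" for y
    using T by (simp add: is_bundle_def)
  have [measurable]: "(\<lambda>x. inner (orth_proj (T x) a) b) \<in> borel_measurable borel" for a b
    by (simp add: inner_orth_proj_polar[OF sub] norm_orth_proj_sq[OF sub])
  have "orth_proj (T x) (u x) \<bullet> b = (\<Sum>a\<in>Basis. (u x \<bullet> a) * (orth_proj (T x) a \<bullet> b))" for x b
  proof -
    have "orth_proj (T x) (u x) = orth_proj (T x) (\<Sum>a\<in>Basis. (u x \<bullet> a) *\<^sub>R a)"
      by (simp add: euclidean_representation)
    then show ?thesis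
      by (simp add: linear_sum[OF linear_orth_proj[OF sub]] linear_scale[OF linear_orth_proj[OF sub]]
          inner_sum_left)
  qed
  then show ?thesis
    by (subst borel_measurable_euclidean_space) simp
qed

section \<open>Tangential gradients and the pairing of L1 with bounded fields\<close>

context radon begin

context
  fixes T :: "'a \<Rightarrow> 'a set"
  assumes T: "is_bundle T"
begin

lemma subspace_T: "subspace (T x)"
  using T by (simp add: is_bundle_def)

lemma tan_grad_add:
  assumes "f \<in> test_functions" "g \<in> test_functions"
  shows "tan_grad T (\<lambda>x. f x + g x) x = tan_grad T f x + tan_grad T g x"
  by (simp add: tan_grad_def grad_add assms linear_add[OF linear_orth_proj[OF subspace_T]])

lemma tan_grad_scale:
  assumes "f \<in> test_functions"
  shows "tan_grad T (\<lambda>x. c * f x) x = c *\<^sub>R tan_grad T f x"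
  by (simp add: tan_grad_def grad_scale assms linear_scale[OF linear_orth_proj[OF subspace_T]])

lemma integrable_tan_grad:
  assumes "f \<in> test_functions"
  shows "integrable \<mu> (tan_grad T f)"
proof (rule Bochner_Integration.integrable_bound)
  show "integrable \<mu> (grad f)"
    by (intro integrable_compact_support continuous_on_grad compact_support_grad assms)
  show "tan_grad T f \<in> borel_measurable \<mu>"
    unfolding tan_grad_def[abs_def]
    using borel_measurable_orth_proj[OF T borel_measurable_continuous_onI[OF continuous_on_grad[OF assms]]]
    by simp
qed (simp add: tan_grad_def norm_orth_proj_le[OF subspace_T])

end

text \<open>The inner product form serves vector fields and, with \<open>real\<close> in place of
  'b, also products of scalar functions.\<close>

lemma integrable_mult_Linfty:
  fixes u :: "'a \<Rightarrow> 'b::euclidean_space"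
  assumes u: "integrable \<mu> u" and v: "v \<in> Linfty \<mu>"
  shows "integrable \<mu> (\<lambda>x. inner (u x) (v x))"
proof -
  obtain C where C: "AE x in \<mu>. norm (v x) \<le> C" and v[measurable]: "v \<in> borel_measurable \<mu>"
    using v by (auto simp: Linfty_def)
  have [measurable]: "u \<in> borel_measurable \<mu>"
    using u by simp
  show ?thesis
  proof (rule Bochner_Integration.integrable_bound)
    show "integrable \<mu> (\<lambda>x. C * norm (u x))"
      using u by simp
    show "AE x in \<mu>. norm (inner (u x) (v x)) \<le> norm (C * norm (u x))"
      using C
    proof eventually_elim
      case (elim x)
      have "norm (inner (u x) (v x)) \<le> norm (u x) * norm (v x)"
        by (simp add: Cauchy_Schwarz_ineq2)
      also have "\<dots> \<le> norm (u x) * \<bar>C\<bar>"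
        using elim by (intro mult_left_mono) auto
      finally show ?case by (simp add: abs_mult mult.commute)
    qed
  qed measurable
qed

lemma L1_tendsto_inner_Linfty:
  fixes u :: "'a \<Rightarrow> 'b::euclidean_space"
  assumes u: "L1_tendsto \<mu> us u" and v: "v \<in> Linfty \<mu>"
  shows "(\<lambda>n. \<integral>x. inner (us n x) (v x) \<partial>\<mu>) \<longlonglongrightarrow> (\<integral>x. inner (u x) (v x) \<partial>\<mu>)"
proof -
  have i: "integrable \<mu> (us n)" "integrable \<mu> u" for n
    using u by (auto simp: L1_tendsto_def L1_def)
  obtain C where C: "AE x in \<mu>. norm (v x) \<le> C"
    using v by (auto simp: Linfty_def)
  have bound: "norm ((\<integral>x. inner (us n x) (v x) \<partial>\<mu>) - (\<integral>x. inner (u x) (v x) \<partial>\<mu>))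
     \<le> C * (\<integral>x. norm (us n x - u x) \<partial>\<mu>)" for n
  proof -
    have "(\<integral>x. inner (us n x) (v x) \<partial>\<mu>) - (\<integral>x. inner (u x) (v x) \<partial>\<mu>)
      = (\<integral>x. inner (us n x - u x) (v x) \<partial>\<mu>)"
      by (simp add: inner_diff_left integrable_mult_Linfty[OF i(1) v] integrable_mult_Linfty[OF i(2) v])
    also have "norm \<dots> \<le> (\<integral>x. norm (inner (us n x - u x) (v x)) \<partial>\<mu>)"
      by (rule integral_norm_bound)
    also have "\<dots> \<le> (\<integral>x. C * norm (us n x - u x) \<partial>\<mu>)"
    proof (rule integral_mono_AE)
      show "integrable \<mu> (\<lambda>x. norm (inner (us n x - u x) (v x)))"
        using integrable_mult_Linfty[OF Bochner_Integration.integrable_diff[OF i] v] by (rule integrable_norm)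
      show "AE x in \<mu>. norm (inner (us n x - u x) (v x)) \<le> C * norm (us n x - u x)"
        using C
      proof eventually_elim
        case (elim x)
        have "norm (inner (us n x - u x) (v x)) \<le> norm (us n x - u x) * norm (v x)"
          by (simp add: Cauchy_Schwarz_ineq2)
        also have "\<dots> \<le> norm (us n x - u x) * C"
          using elim by (intro mult_left_mono) auto
        finally show ?case by (simp add: mult.commute)
      qed
    qed (use i in simp)
    finally show ?thesis using i by simp
  qed
  have "(\<lambda>n. C * (\<integral>x. norm (us n x - u x) \<partial>\<mu>)) \<longlonglongrightarrow> 0"
    using u by (intro tendsto_mult_right_zero) (simp add: L1_tendsto_def)
  then have "(\<lambda>n. (\<integral>x. inner (us n x) (v x) \<partial>\<mu>) - (\<integral>x. inner (u x) (v x) \<partial>\<mu>)) \<longlonglongrightarrow> 0"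
    by (rule Lim_null_comparison[OF always_eventually[OF allI[OF bound]]])
  then show ?thesis
    by (rule LIM_zero_cancel)
qed

end

subsection \<open>Uniqueness of the tangential gradient\<close>

context radon begin

text \<open>Multiplication by test functions localizes identities between integrals, which later
  turns an integrated orthogonality into a pointwise one. It rests on the Leibniz rule, applied to
  the test function f \<phi>.\<close>

lemma D_inf_div_mult:
  assumes v: "v \<in> D_inf_div \<mu>" and \<phi>: "\<phi> \<in> test_functions"
  shows "(\<lambda>x. \<phi> x *\<^sub>R v x) \<in> D_inf_div \<mu>"
proof -
  obtain g where vL: "v \<in> Linfty \<mu>" and gL: "g \<in> Linfty \<mu>"
    and ibp: "\<And>f. f \<in> test_functions \<Longrightarrow> (\<integral>x. inner (grad f x) (v x) \<partial>\<mu>) = - (\<integral>x. f x * g x \<partial>\<mu>)"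
    using v by (auto simp: D_inf_div_def)
  obtain C1 where C1: "AE x in \<mu>. norm (v x) \<le> C1" and [measurable]: "v \<in> borel_measurable borel"
    using vL by (auto simp: Linfty_def)
  obtain C2 where C2: "AE x in \<mu>. norm (g x) \<le> C2" and [measurable]: "g \<in> borel_measurable borel"
    using gL by (auto simp: Linfty_def)
  obtain P where P: "\<And>x. norm (\<phi> x) \<le> P"
    using integrable_compact_support(2)[OF test_functions_D(3,5)[OF \<phi>]] by blast
  obtain Q where Q: "\<And>x. norm (grad \<phi> x) \<le> Q"
    using integrable_compact_support(2)[OF continuous_on_grad[OF \<phi>] compact_support_grad[OF \<phi>]] by blast
  have [measurable]: "\<phi> \<in> borel_measurable borel" "grad \<phi> \<in> borel_measurable borel"
    by (intro borel_measurable_continuous_onI test_functions_D continuous_on_grad \<phi>)+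
  \<comment> \<open>The divergence of \<phi> v prescribed by the Leibniz rule; it is bounded because
    \<phi> and its gradient are continuous with compact support.\<close>
  define g' where "g' x = \<phi> x * g x + inner (grad \<phi> x) (v x)" for x
  have "AE x in \<mu>. norm (\<phi> x *\<^sub>R v x) \<le> P * C1"
    using C1 by eventually_elim (use P in \<open>auto intro!: mult_mono order_trans[OF norm_ge_zero P]\<close>)
  then have 1: "(\<lambda>x. \<phi> x *\<^sub>R v x) \<in> Linfty \<mu>"
    by (auto simp: Linfty_def)
  have "AE x in \<mu>. norm (g' x) \<le> P * C2 + Q * C1"
    using C1 C2
  proof eventually_elim
    case (elim x)
    have "norm (\<phi> x * g x) \<le> P * C2"
      unfolding norm_mult using P elim by (intro mult_mono) (auto intro: order_trans[OF norm_ge_zero P])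
    moreover have "norm (inner (grad \<phi> x) (v x)) \<le> norm (grad \<phi> x) * norm (v x)"
      by (simp add: Cauchy_Schwarz_ineq2)
    moreover have "norm (grad \<phi> x) * norm (v x) \<le> Q * C1"
      using Q elim by (intro mult_mono) (auto intro: order_trans[OF norm_ge_zero Q])
    ultimately show ?case
      unfolding g'_def by (intro order_trans[OF norm_triangle_ineq]) linarith
  qed
  then have 2: "g' \<in> Linfty \<mu>"
    unfolding Linfty_def g'_def[abs_def] by auto
  have "(\<integral>x. inner (grad f x) (\<phi> x *\<^sub>R v x) \<partial>\<mu>) = - (\<integral>x. f x * g' x \<partial>\<mu>)"
    if f: "f \<in> test_functions" for f
  proof -
    have f\<phi>: "(\<lambda>x. f x * \<phi> x) \<in> test_functions"
      by (intro test_functions_mult f test_functions_D(1)[OF \<phi>])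
    have i1: "integrable \<mu> (\<lambda>x. inner (grad (\<lambda>x. f x * \<phi> x) x) (v x))"
      by (intro integrable_mult_Linfty vL integrable_compact_support continuous_on_grad compact_support_grad f\<phi>)
    have i2: "integrable \<mu> (\<lambda>x. inner (f x *\<^sub>R grad \<phi> x) (v x))"
    proof (intro integrable_mult_Linfty vL integrable_compact_support)
      show "continuous_on UNIV (\<lambda>x. f x *\<^sub>R grad \<phi> x)"
        by (intro continuous_intros test_functions_D continuous_on_grad \<phi> f)
      show "compact (closure {x. f x *\<^sub>R grad \<phi> x \<noteq> 0})"
        by (rule compact_closure_mono[OF compact_support_grad[OF \<phi>]]) auto
    qed
    have i3: "integrable \<mu> (\<lambda>x. (f x * \<phi> x) * g x)"
      using integrable_mult_Linfty[OF integrable_compact_support(1)[OF test_functions_D(3,5)[OF f\<phi>]] gL]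
      by simp
    have "(\<integral>x. inner (grad f x) (\<phi> x *\<^sub>R v x) \<partial>\<mu>)
      = (\<integral>x. inner (grad (\<lambda>x. f x * \<phi> x) x) (v x) - inner (f x *\<^sub>R grad \<phi> x) (v x) \<partial>\<mu>)"
      by (intro Bochner_Integration.integral_cong) (auto simp: grad_mult f \<phi> inner_add_left)
    also have "\<dots> = - (\<integral>x. (f x * \<phi> x) * g x \<partial>\<mu>) - (\<integral>x. inner (f x *\<^sub>R grad \<phi> x) (v x) \<partial>\<mu>)"
      using i1 i2 by (simp add: ibp[OF f\<phi>])
    also have "\<dots> = - (\<integral>x. (f x * \<phi> x) * g x + inner (f x *\<^sub>R grad \<phi> x) (v x) \<partial>\<mu>)"
      using i2 i3 by simp
    also have "(\<integral>x. (f x * \<phi> x) * g x + inner (f x *\<^sub>R grad \<phi> x) (v x) \<partial>\<mu>) = (\<integral>x. f x * g' x \<partial>\<mu>)"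
      by (intro Bochner_Integration.integral_cong) (auto simp: g'_def algebra_simps)
    finally show ?thesis .
  qed
  with 1 2 show ?thesis
    unfolding D_inf_div_def by blast
qed

lemma L1_tendsto_AE_subseq:
  fixes u :: "nat \<Rightarrow> 'a \<Rightarrow> 'b::{banach, second_countable_topology}"
  assumes "L1_tendsto \<mu> u w"
  obtains s where "strict_mono s" "AE x in \<mu>. (\<lambda>n. u (s n) x) \<longlonglongrightarrow> w x"
proof -
  have "integrable \<mu> (\<lambda>x. u n x - w x)" for n
    using assms by (auto simp: L1_tendsto_def L1_def)
  from tendsto_L1_AE_subseq[of \<mu> "\<lambda>n x. u n x - w x", OF this] assms
  obtain s where s: "strict_mono s" "AE x in \<mu>. (\<lambda>n. u (s n) x - w x) \<longlonglongrightarrow> 0"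
    by (auto simp: L1_tendsto_def)
  from s(2) have "AE x in \<mu>. (\<lambda>n. u (s n) x) \<longlonglongrightarrow> w x"
    by eventually_elim (rule LIM_zero_cancel)
  with s(1) show ?thesis by (rule that)
qed

text \<open>A subsequence converges almost everywhere, and finite-dimensional subspaces are
  closed.\<close>

lemma AE_mem_subspace_L1_limit:
  assumes T: "is_bundle T" and "L1_tendsto \<mu> u w" and u: "\<And>n x. u n x \<in> T x"
  shows "AE x in \<mu>. w x \<in> T x"
proof -
  obtain s where "AE x in \<mu>. (\<lambda>n. u (s n) x) \<longlonglongrightarrow> w x"
    using assms(2) by (rule L1_tendsto_AE_subseq)
  then show ?thesis
  proof eventually_elim
    case (elim x)
    have "closed (T x)" using T by (auto simp: is_bundle_def closed_subspace)
    then show ?case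
      using closed_sequentially[OF _ _ elim] u by blast
  qed
qed

text \<open>Since \<open>v\<close> lies in \<open>T\<close> almost everywhere, projecting a gradient
  onto \<open>T\<close> does not change its product with \<open>v\<close>. So integration by parts
  holds for tangential gradients of test functions, and both sides pass to the L1 limit.\<close>

lemma sobolev_grad_integral:
  assumes T: "is_bundle T" "carries_D_inf_div \<mu> T" and w: "is_sobolev_grad \<mu> T f w"
    and v: "v \<in> Linfty \<mu>" and vD: "v \<in> D_inf_div \<mu>" and g: "g \<in> Linfty \<mu>"
    and ibp: "\<And>\<phi>. \<phi> \<in> test_functions \<Longrightarrow> (\<integral>x. inner (grad \<phi> x) (v x) \<partial>\<mu>) = - (\<integral>x. \<phi> x * g x \<partial>\<mu>)"
  shows "(\<integral>x. inner (w x) (v x) \<partial>\<mu>) = - (\<integral>x. f x * g x \<partial>\<mu>)"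
proof -
  obtain fs where fs: "\<And>n. fs n \<in> test_functions" "L1_tendsto \<mu> fs f"
    and gr: "L1_tendsto \<mu> (\<lambda>n. tan_grad T (fs n)) w"
    using w by (auto simp: is_sobolev_grad_def)
  have "(\<integral>x. inner (tan_grad T (fs n) x) (v x) \<partial>\<mu>) = - (\<integral>x. fs n x * g x \<partial>\<mu>)" for n
  proof -
    have "AE x in \<mu>. v x \<in> T x" using T vD by (simp add: carries_D_inf_div_def)
    then have "AE x in \<mu>. inner (tan_grad T (fs n) x) (v x) = inner (grad (fs n) x) (v x)"
      by eventually_elim (simp add: tan_grad_def orth_proj_inner[OF subspace_T[OF T(1)]])
    moreover have "v \<in> borel_measurable borel" using v by (simp add: Linfty_def)
    ultimately have "(\<integral>x. inner (tan_grad T (fs n) x) (v x) \<partial>\<mu>) = (\<integral>x. inner (grad (fs n) x) (v x) \<partial>\<mu>)"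
      using borel_measurable_integrable[OF integrable_tan_grad[OF T(1) fs(1)]]
        borel_measurable_continuous_onI[OF continuous_on_grad[OF fs(1)]]
      by (intro integral_cong_AE) (auto intro!: borel_measurable_inner)
    then show ?thesis by (simp add: ibp[OF fs(1)])
  qed
  then have "(\<lambda>n. - (\<integral>x. inner (fs n x) (g x) \<partial>\<mu>)) \<longlonglongrightarrow> (\<integral>x. inner (w x) (v x) \<partial>\<mu>)"
    using L1_tendsto_inner_Linfty[OF gr v] by simp
  moreover have "(\<lambda>n. - (\<integral>x. inner (fs n x) (g x) \<partial>\<mu>)) \<longlonglongrightarrow> - (\<integral>x. inner (f x) (g x) \<partial>\<mu>)"
    by (intro tendsto_minus L1_tendsto_inner_Linfty fs g)
  ultimately show ?thesis
    using LIMSEQ_unique by fastforce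
qed

lemma sobolev_grad_unique:
  assumes T: "is_tangent_bundle \<mu> T"
    and w: "is_sobolev_grad \<mu> T f w" "is_sobolev_grad \<mu> T f w'"
  shows "AE x in \<mu>. w x = w' x"
proof -
  have T': "is_bundle T" "carries_D_inf_div \<mu> T"
    using T by (auto simp: is_tangent_bundle_def)
  have i: "integrable \<mu> w" "integrable \<mu> w'" and mem: "AE x in \<mu>. w x \<in> T x" "AE x in \<mu>. w' x \<in> T x"
    using w by (auto simp: is_sobolev_grad_def Gamma1_def L1_def)
  define z where "z x = w x - w' x" for x
  have z: "integrable \<mu> z" unfolding z_def[abs_def] using i by simp
  have "AE x in \<mu>. inner (z x) (v x) = 0" if v: "v \<in> D_inf_div \<mu>" for v
  proof (rule AE_eq_0_if_test_functions)
    have vL: "v \<in> Linfty \<mu>" using v by (simp add: D_inf_div_def)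
    then show "integrable \<mu> (\<lambda>x. inner (z x) (v x))"
      by (intro integrable_mult_Linfty z)
    fix \<phi> :: "'a \<Rightarrow> real" assume \<phi>: "\<phi> \<in> test_functions"
    \<comment> \<open>Both gradients satisfy the same integration by parts against the localized
      field \<phi> v, so their difference integrates to 0 against it; as \<phi> is arbitrary, the
      orthogonality holds pointwise.\<close>
    let ?v = "\<lambda>x. \<phi> x *\<^sub>R v x"
    have v': "?v \<in> D_inf_div \<mu>" using D_inf_div_mult[OF v \<phi>] .
    then obtain g where vL': "?v \<in> Linfty \<mu>" and g: "g \<in> Linfty \<mu>"
      and ibp: "\<And>f. f \<in> test_functions \<Longrightarrow> (\<integral>x. inner (grad f x) (?v x) \<partial>\<mu>) = - (\<integral>x. f x * g x \<partial>\<mu>)"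
      unfolding D_inf_div_def by blast
    have "(\<integral>x. inner (w x) (?v x) \<partial>\<mu>) = (\<integral>x. inner (w' x) (?v x) \<partial>\<mu>)"
      using sobolev_grad_integral[OF T' w(1) vL' v' g ibp] sobolev_grad_integral[OF T' w(2) vL' v' g ibp]
      by simp
    moreover have "(\<integral>x. \<phi> x * inner (z x) (v x) \<partial>\<mu>) = (\<integral>x. inner (w x) (?v x) - inner (w' x) (?v x) \<partial>\<mu>)"
      by (intro Bochner_Integration.integral_cong) (auto simp: z_def inner_diff_left algebra_simps)
    ultimately show "(\<integral>x. \<phi> x * inner (z x) (v x) \<partial>\<mu>) = 0"
      using integrable_mult_Linfty[OF i(1) vL'] integrable_mult_Linfty[OF i(2) vL']
      by (simp only: Bochner_Integration.integral_diff)
  qed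
  \<comment> \<open>The orthogonal complement of \<open>z\<close> thus competes with
    \<open>T\<close>, and minimality puts \<open>T\<close> inside it. As \<open>z\<close> is itself
    in \<open>T\<close>, it is orthogonal to itself.\<close>
  then have "carries_D_inf_div \<mu> (\<lambda>x. {y. inner (z x) y = 0})"
    by (simp add: carries_D_inf_div_def)
  moreover have "is_bundle (\<lambda>x. {y. inner (z x) y = 0})"
    using borel_measurable_integrable[OF z] by (intro is_bundle_hyperplane) simp
  ultimately have "AE x in \<mu>. T x \<subseteq> {y. inner (z x) y = 0}"
    using T unfolding is_tangent_bundle_def by blast
  with mem show ?thesis
  proof eventually_elim
    case (elim x)
    then have "z x \<in> T x"
      unfolding z_def by (intro subspace_diff subspace_T[OF T'(1)])
    then show ?case using elim by (auto simp: z_def)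
  qed
qed

end

subsection \<open>Convergent selections in L1\<close>

text \<open>Quantitative strict convexity of u \<mapsto> |(r, u)| on the ball of radius K r: the
  distance of two points is controlled by the convexity defect at their midpoint. The free parameter
  \<eta> makes the estimate linear in the defect, so that it can be integrated.\<close>

lemma sqrt_midpoint_gap:
  fixes u v :: "'b::real_inner"
  assumes r: "r > 0" and K: "norm u \<le> K * r" "norm v \<le> K * r" and \<eta>: "\<eta> > 0"
  shows "norm (u - v) \<le> \<eta> * r + 4 * (1 + K) ^ 3 / \<eta> *
    (sqrt (r\<^sup>2 + (norm u)\<^sup>2) + sqrt (r\<^sup>2 + (norm v)\<^sup>2)
      - 2 * sqrt (r\<^sup>2 + (norm ((1/2) *\<^sub>R (u + v)))\<^sup>2))"
proof -
  define A B M where "A = sqrt (r\<^sup>2 + (norm u)\<^sup>2)" and "B = sqrt (r\<^sup>2 + (norm v)\<^sup>2)"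
    and "M = 2 * sqrt (r\<^sup>2 + (norm ((1/2) *\<^sub>R (u + v)))\<^sup>2)"
  have K0: "K \<ge> 0"
    using K(1) r norm_ge_zero[of u] by (metis mult_less_0_iff not_less order_trans)
  define L where "L = (1 + K) * r"
  have L: "L > 0"
    using K0 r by (simp add: L_def)
  have AL: "0 < A" "A \<le> L" if "norm u \<le> K * r" "A = sqrt (r\<^sup>2 + (norm u)\<^sup>2)" for u :: 'b and A
  proof -
    show "0 < A" using r by (simp add: that add_pos_nonneg)
    have "sqrt (r\<^sup>2 + (norm u)\<^sup>2) \<le> r + norm u"
      using sqrt_add_le_add_sqrt[of "r\<^sup>2" "(norm u)\<^sup>2"] r by simp
    then show "A \<le> L" using that by (simp add: L_def algebra_simps)
  qed
  note A = AL[OF K(1) A_def] and B = AL[OF K(2) B_def]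
  have A2: "A\<^sup>2 = r\<^sup>2 + inner u u" and B2: "B\<^sup>2 = r\<^sup>2 + inner v v"
    by (simp_all add: A_def B_def power2_norm_eq_inner)
  have M2: "M\<^sup>2 = 4 * r\<^sup>2 + inner u u + 2 * inner u v + inner v v"
  proof -
    have "M\<^sup>2 = 4 * (r\<^sup>2 + inner ((1/2) *\<^sub>R (u + v)) ((1/2) *\<^sub>R (u + v)))"
      unfolding M_def power_mult_distrib by (subst real_sqrt_pow2) (simp_all only: power2_norm_eq_inner, auto)
    then show ?thesis
      by (simp add: inner_add_left inner_add_right inner_commute)
  qed
  have M0: "M \<ge> 0" by (simp add: M_def)
  \<comment> \<open>In the product space, \<open>A\<close> and \<open>B\<close> are the norms of (r,
    u) and (r, v), \<open>c\<close> is their inner product, and \<open>M\<close> is the norm of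
    their sum.\<close>
  define c where "c = r\<^sup>2 + inner u v"
  define D where "D = (norm (u - v))\<^sup>2"
  have D: "D = inner u u - 2 * inner u v + inner v v"
    by (simp add: D_def power2_norm_eq_inner inner_diff_left inner_diff_right inner_commute)
  have cs: "(inner u v)\<^sup>2 \<le> inner u u * inner v v"
    using Cauchy_Schwarz_ineq by blast
  \<comment> \<open>The Gram determinant of (r, u) and (r, v). Its second summand is the Gram
    determinant of u and v, which is non-negative by Cauchy-Schwarz.\<close>
  have "(A * B)\<^sup>2 - c\<^sup>2 = r\<^sup>2 * D + (inner u u * inner v v - (inner u v)\<^sup>2)"
    unfolding power_mult_distrib A2 B2 c_def D by (simp add: power2_eq_square algebra_simps)
  then have 1: "(A * B - c) * (A * B + c) \<ge> r\<^sup>2 * D"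
    using cs by (simp add: power2_eq_square algebra_simps)
  have D0: "D \<ge> 0" by (simp add: D_def)
  have AB: "0 < A * B" "A * B \<le> L\<^sup>2"
    using A B L by (auto simp: power2_eq_square intro!: mult_mono)
  have cAB: "\<bar>c\<bar> \<le> A * B"
  proof -
    have "c\<^sup>2 \<le> (A * B)\<^sup>2"
      using \<open>(A * B)\<^sup>2 - c\<^sup>2 = _\<close> cs mult_nonneg_nonneg[OF zero_le_power2[of r] D0] by linarith
    then show ?thesis using AB by (metis abs_le_square_iff abs_of_pos)
  qed
  have 2: "r\<^sup>2 * D \<le> (A * B - c) * (2 * L\<^sup>2)"
    using 1 cAB AB mult_left_mono[of "A * B + c" "2 * L\<^sup>2" "A * B - c"] by linarith
  have 3: "(A + B)\<^sup>2 - M\<^sup>2 = 2 * (A * B - c)"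
    unfolding power2_sum A2 B2 M2 c_def by simp
  have MAB: "M \<le> A + B"
  proof (rule power2_le_imp_le)
    have "0 \<le> (A + B)\<^sup>2 - M\<^sup>2" unfolding 3 using cAB by (simp add: abs_le_iff)
    then show "M\<^sup>2 \<le> (A + B)\<^sup>2" by (simp only: diff_ge_0_iff_ge)
    show "0 \<le> A + B" using A B by linarith
  qed
  have "(A + B)\<^sup>2 - M\<^sup>2 = (A + B - M) * (A + B + M)"
    by (simp add: power2_eq_square algebra_simps)
  also have "\<dots> \<le> (A + B - M) * (4 * L)"
    using MAB A B by (intro mult_left_mono) auto
  finally have "A * B - c \<le> (A + B - M) * (2 * L)"
    using 3 by simp
  then have "(A * B - c) * (2 * L\<^sup>2) \<le> (A + B - M) * (2 * L) * (2 * L\<^sup>2)"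
    by (intro mult_right_mono) auto
  with 2 have "r\<^sup>2 * D \<le> (A + B - M) * (4 * L ^ 3)"
    by (simp add: power2_eq_square power3_eq_cube algebra_simps)
  then have "r\<^sup>2 * D \<le> r\<^sup>2 * (4 * (1 + K) ^ 3 * r * (A + B - M))"
    by (simp add: L_def power_mult_distrib power2_eq_square power3_eq_cube algebra_simps)
  then have DD: "D \<le> 4 * (1 + K) ^ 3 * r * (A + B - M)"
    using r by simp
  define N where "N = norm (u - v)"
  \<comment> \<open>Young's inequality. Division by \<eta> r turns the bound on the squared
    distance, which has a factor r, into a bound on the distance itself.\<close>
  have "N * (\<eta> * r) \<le> (\<eta> * r)\<^sup>2 + N\<^sup>2"
  proof -
    have "2 * (N * (\<eta> * r)) \<le> N\<^sup>2 + (\<eta> * r)\<^sup>2"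
      using sum_squares_bound[of N "\<eta> * r"] by simp
    moreover have "0 \<le> N * (\<eta> * r)" using r \<eta> by (simp add: N_def)
    ultimately show ?thesis by linarith
  qed
  also have "\<dots> \<le> (\<eta> * r)\<^sup>2 + 4 * (1 + K) ^ 3 * r * (A + B - M)"
    using DD by (simp add: N_def D_def)
  finally have "N \<le> ((\<eta> * r)\<^sup>2 + 4 * (1 + K) ^ 3 * r * (A + B - M)) / (\<eta> * r)"
    using r \<eta> by (simp add: pos_le_divide_eq)
  also have "\<dots> = \<eta> * r + 4 * (1 + K) ^ 3 / \<eta> * (A + B - M)"
    using r \<eta> by (simp add: field_simps power2_eq_square)
  finally show ?thesis
    by (simp add: N_def A_def B_def M_def)
qed

text \<open>The triangle inequality for (r, u) and (r, v) in the product space.\<close>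

lemma sqrt_midpoint_le:
  fixes u v :: "'b::real_inner"
  shows "2 * sqrt (r\<^sup>2 + (norm ((1/2) *\<^sub>R (u + v)))\<^sup>2) \<le> sqrt (r\<^sup>2 + (norm u)\<^sup>2) + sqrt (r\<^sup>2 + (norm v)\<^sup>2)"
proof -
  have "2 * sqrt (r\<^sup>2 + (norm ((1/2) *\<^sub>R (u + v)))\<^sup>2) = norm ((r, u) + (r, v))"
  proof -
    have "(r, u) + (r, v) = 2 *\<^sub>R (r, (1/2) *\<^sub>R (u + v))"
      by (simp add: scaleR_2)
    then show ?thesis
      by (simp only: norm_scaleR norm_Pair) simp
  qed
  also have "\<dots> \<le> norm (r, u) + norm (r, v)"
    by (rule norm_triangle_ineq)
  finally show ?thesis by (simp add: norm_Pair)
qed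

text \<open>Removes the size restriction of \<open>sqrt_midpoint_gap\<close>: large values are paid
  for by their excess over K r, which uniform integrability makes small in the mean.\<close>

lemma norm_diff_midpoint_gap:
  fixes u v :: "'b::real_inner"
  assumes r: "r > 0" and K: "K \<ge> 0" and \<eta>: "\<eta> > 0"
  shows "norm (u - v) \<le> \<eta> * r + 4 * (1 + 2 * K) ^ 3 / \<eta> *
    (sqrt (r\<^sup>2 + (norm u)\<^sup>2) + sqrt (r\<^sup>2 + (norm v)\<^sup>2)
      - 2 * sqrt (r\<^sup>2 + (norm ((1/2) *\<^sub>R (u + v)))\<^sup>2))
    + 4 * max 0 (norm u - K * r) + 4 * max 0 (norm v - K * r)"
    (is "_ \<le> _ + ?c * ?gap + _ + _")
proof (cases "norm u \<le> 2 * K * r \<and> norm v \<le> 2 * K * r")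
  case True
  then show ?thesis
    using sqrt_midpoint_gap[OF r _ _ \<eta>, of u "2 * K" v] by (simp add: add_increasing2)
next
  case False
  have "0 \<le> ?c * ?gap"
    using sqrt_midpoint_le[of r u v] K \<eta> by (intro mult_nonneg_nonneg) auto
  moreover have "norm (u - v) \<le> norm u + norm v"
    by (rule norm_triangle_ineq4)
  moreover have "0 \<le> \<eta> * r" using \<eta> r by simp
  \<comment> \<open>A norm above 2 K r is less than twice its excess over K r. If only one vector is
    that large, its norm also dominates the other, whence the factor 4.\<close>
  ultimately show ?thesis
    using False by (auto simp: max_def not_le)
qed

text \<open>Completeness of L1: a subsequence is Cauchy almost everywhere, and Fatou's lemma along
  it carries the Cauchy bounds over to its limit.\<close>

lemma L1_Cauchy_imp_tendsto:
  fixes u :: "nat \<Rightarrow> 'a \<Rightarrow> 'b::{banach, second_countable_topology}"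
  assumes u: "\<And>n. integrable M (u n)"
    and Cauchy: "\<And>e. e > 0 \<Longrightarrow> \<exists>N. \<forall>m\<ge>N. \<forall>n\<ge>N. (\<integral>x. norm (u m x - u n x) \<partial>M) < e"
  shows "\<exists>w. L1_tendsto M u w"
proof -
  have [measurable]: "u n \<in> borel_measurable M" for n
    using u by simp
  obtain s where s: "strict_mono s" and AE: "AE x in M. Cauchy (\<lambda>i. u (s i) x)"
    using cauchy_L1_AE_cauchy_subseq[OF u Cauchy] by blast
  \<comment> \<open>Where the subsequence diverges, \<open>lim\<close> is an unspecified value; this
    happens on a null set only.\<close>
  define w where "w x = lim (\<lambda>i. u (s i) x)" for x
  have [measurable]: "w \<in> borel_measurable M"
    unfolding w_def by measurable
  have lim: "AE x in M. (\<lambda>i. u (s i) x) \<longlonglongrightarrow> w x"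
    using AE by eventually_elim (simp add: w_def Cauchy_convergent_iff convergent_LIMSEQ_iff)
  have bound: "(\<integral>\<^sup>+x. norm (u m x - w x) \<partial>M) \<le> ennreal e"
    if N: "\<forall>m\<ge>N. \<forall>n\<ge>N. (\<integral>x. norm (u m x - u n x) \<partial>M) < e" and "m \<ge> N" for e N m
  proof -
    have "(\<integral>\<^sup>+x. norm (u m x - w x) \<partial>M) = (\<integral>\<^sup>+x. liminf (\<lambda>i. ennreal (norm (u m x - u (s i) x))) \<partial>M)"
    proof (rule nn_integral_cong_AE, use lim in eventually_elim)
      case (elim x)
      then have "(\<lambda>i. ennreal (norm (u m x - u (s i) x))) \<longlonglongrightarrow> ennreal (norm (u m x - w x))"
        by (intro tendsto_intros)
      then show ?case
        by (rule lim_imp_Liminf[OF trivial_limit_sequentially, symmetric])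
    qed
    also have "\<dots> \<le> liminf (\<lambda>i. \<integral>\<^sup>+x. ennreal (norm (u m x - u (s i) x)) \<partial>M)"
      by (intro nn_integral_liminf) measurable
    also have "\<dots> \<le> ennreal e"
    proof (rule Liminf_le)
      show "\<forall>\<^sub>F i in sequentially. (\<integral>\<^sup>+x. ennreal (norm (u m x - u (s i) x)) \<partial>M) \<le> ennreal e"
      proof (rule eventually_sequentiallyI[of N])
        fix i assume "N \<le> i"
        then have "s i \<ge> N"
          using seq_suble[OF s, of i] by linarith
        then have "(\<integral>x. norm (u m x - u (s i) x) \<partial>M) \<le> e"
          using N \<open>m \<ge> N\<close> by (auto intro: less_imp_le)
        then show "(\<integral>\<^sup>+x. ennreal (norm (u m x - u (s i) x)) \<partial>M) \<le> ennreal e"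
          using u by (subst nn_integral_eq_integral) (auto intro: ennreal_leI)
      qed
    qed simp
    finally show ?thesis .
  qed
  have w: "integrable M w"
  proof -
    obtain N where "\<forall>m\<ge>N. \<forall>n\<ge>N. (\<integral>x. norm (u m x - u n x) \<partial>M) < 1"
      using Cauchy[of 1] by auto
    then have "(\<integral>\<^sup>+x. norm (u N x - w x) \<partial>M) < \<infinity>"
      using bound[of N 1 N] by (auto intro: le_less_trans)
    then have "integrable M (\<lambda>x. u N x - w x)"
      by (intro integrableI_bounded) measurable
    from Bochner_Integration.integrable_diff[OF u[of N] this] show ?thesis by simp
  qed
  have "(\<lambda>n. \<integral>x. norm (u n x - w x) \<partial>M) \<longlonglongrightarrow> 0"
  proof (rule LIMSEQ_I)
    fix e :: real assume e: "0 < e"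
    then obtain N where N: "\<forall>m\<ge>N. \<forall>n\<ge>N. (\<integral>x. norm (u m x - u n x) \<partial>M) < e / 2"
      using Cauchy[of "e / 2"] by auto
    have "(\<integral>x. norm (u m x - w x) \<partial>M) < e" if "m \<ge> N" for m
    proof -
      have "ennreal (\<integral>x. norm (u m x - w x) \<partial>M) \<le> ennreal (e / 2)"
        using bound[OF N that] u w by (subst (asm) nn_integral_eq_integral) auto
      then show ?thesis using e by (simp add: ennreal_le_iff)
    qed
    then show "\<exists>N. \<forall>m\<ge>N. norm ((\<integral>x. norm (u m x - w x) \<partial>M) - 0) < e"
      by auto
  qed
  then show ?thesis
    using u w by (auto simp: L1_tendsto_def L1_def)
qed

text \<open>A substitute for weak compactness followed by Mazur's lemma: near-minimizers of the strictly
  convex functional \<open>u \<mapsto> \<integral> sqrt (r\<^sup>2 + |u|\<^sup>2)\<close> over the shrinking sets \<open>D n\<close> form a Cauchy sequence.\<close>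

lemma L1_convergent_selection:
  fixes D :: "nat \<Rightarrow> ('a \<Rightarrow> 'b::euclidean_space) set"
  assumes r: "integrable M r" "\<And>x. r x > (0::real)"
    and anti: "\<And>m n. m \<le> n \<Longrightarrow> D n \<subseteq> D m"
    and ne: "\<And>n. D n \<noteq> {}"
    and int: "\<And>n u. u \<in> D n \<Longrightarrow> integrable M u"
    and mid: "\<And>n u v. u \<in> D n \<Longrightarrow> v \<in> D n \<Longrightarrow> (\<lambda>x. (1/2) *\<^sub>R (u x + v x)) \<in> D n"
    and ui: "\<And>e. e > 0 \<Longrightarrow> \<exists>K\<ge>0. \<exists>N. \<forall>u\<in>D N. (\<integral>x. max 0 (norm (u x) - K * r x) \<partial>M) \<le> e"
  shows "\<exists>u w. (\<forall>n. u n \<in> D n) \<and> L1_tendsto M u w"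
proof -
  define \<Phi> where "\<Phi> u x = sqrt ((r x)\<^sup>2 + (norm (u x))\<^sup>2)" for u :: "'a \<Rightarrow> 'b" and x
  define J where "J u = (\<integral>x. \<Phi> u x \<partial>M)" for u
  have [measurable]: "r \<in> borel_measurable M" using r by simp
  have \<Phi>_le: "\<Phi> u x \<le> r x + norm (u x)" for u x
    using sqrt_add_le_add_sqrt[of "(r x)\<^sup>2" "(norm (u x))\<^sup>2"] r(2)[of x] by (simp add: \<Phi>_def)
  have \<Phi>_int: "integrable M (\<Phi> u)" if u: "integrable M u" for u
  proof (rule Bochner_Integration.integrable_bound)
    show "integrable M (\<lambda>x. r x + norm (u x))" using r u by simp
    have [measurable]: "u \<in> borel_measurable M" using u by simp
    show "\<Phi> u \<in> borel_measurable M"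
      unfolding \<Phi>_def[abs_def] by measurable
    have "\<bar>\<Phi> u x\<bar> \<le> \<bar>r x + norm (u x)\<bar>" for x
      using \<Phi>_le[of u x] by (simp add: \<Phi>_def)
    then show "AE x in M. norm (\<Phi> u x) \<le> norm (r x + norm (u x))" by simp
  qed
  have J0: "0 \<le> J u" for u
    unfolding J_def by (intro integral_nonneg_AE) (simp add: \<Phi>_def)
  define d where "d n = (INF u\<in>D n. J u)" for n
  have bdd: "bdd_below (J ` D n)" for n
    using J0 by (intro bdd_belowI[of _ 0]) auto
  have d_le: "d n \<le> J u" if "u \<in> D n" for n u
    unfolding d_def using bdd that by (rule cINF_lower)
  have "incseq d"
    unfolding incseq_def d_def by (intro allI impI cINF_superset_mono bdd ne anti order_refl)
  moreover have "\<exists>B. \<forall>n. d n \<le> B"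
  proof -
    obtain K N where K: "K \<ge> 0" and N: "\<And>u. u \<in> D N \<Longrightarrow> (\<integral>x. max 0 (norm (u x) - K * r x) \<partial>M) \<le> 1"
      using ui[of 1] by auto
    have "d n \<le> (1 + K) * (\<integral>x. r x \<partial>M) + 1" for n
    proof -
      \<comment> \<open>The index max n N serves twice: the infimum \<open>d\<close> increases along
        the sets, and the chosen field also lies in \<open>D N\<close>, where the excess is at most
        1.\<close>
      obtain u where u: "u \<in> D (max n N)" using ne by blast
      then have uN: "u \<in> D N" and i: "integrable M u" using anti[of N "max n N"] int by auto
      have "d n \<le> d (max n N)" using \<open>incseq d\<close> by (simp add: incseq_def)
      also have "\<dots> \<le> J u" using d_le[OF u] .
      also have "\<dots> \<le> (\<integral>x. (1 + K) * r x + max 0 (norm (u x) - K * r x) \<partial>M)"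
        unfolding J_def
      proof (rule integral_mono)
        show "\<Phi> u x \<le> (1 + K) * r x + max 0 (norm (u x) - K * r x)" for x
          using \<Phi>_le[of u x] by (simp add: algebra_simps)
      qed (use r i \<Phi>_int in auto)
      also have "\<dots> = (1 + K) * (\<integral>x. r x \<partial>M) + (\<integral>x. max 0 (norm (u x) - K * r x) \<partial>M)"
        using r i by simp
      finally show ?thesis using N[OF uN] by simp
    qed
    then show ?thesis by blast
  qed
  ultimately obtain l where l: "d \<longlonglongrightarrow> l" and dl: "\<And>n. d n \<le> l"
    using incseq_convergent by metis
  have "\<exists>u\<in>D n. J u < d n + inverse (Suc n)" for n
  proof -
    have "\<exists>y\<in>J ` D n. y < d n + inverse (real (Suc n))"
      using cInf_lessD[of "J ` D n" "d n + inverse (real (Suc n))"] ne unfolding d_def by auto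
    then show ?thesis by auto
  qed
  then obtain u where u: "\<And>n. u n \<in> D n" "\<And>n. J (u n) < d n + inverse (Suc n)"
    by metis
  have ui': "integrable M (u n)" for n using int u by blast
  define gap where "gap m n x = \<Phi> (u m) x + \<Phi> (u n) x - 2 * \<Phi> (\<lambda>x. (1/2) *\<^sub>R (u m x + u n x)) x" for m n x
  have gap_int: "integrable M (gap m n)" for m n
    unfolding gap_def[abs_def] using ui' by (intro Bochner_Integration.integrable_diff
        Bochner_Integration.integrable_add integrable_mult_right \<Phi>_int) auto
  have gap_bound: "(\<integral>x. gap m n x \<partial>M) \<le> 2 * (l - d N) + 2 * inverse (Suc N)" if "m \<ge> N" "n \<ge> N" for m n N
  proof -
    \<comment> \<open>Both fields, hence also their midpoint, lie in \<open>D N\<close>. So the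
      functional is at least \<open>d N\<close> at the midpoint, while at the two fields it is at
      most \<open>l\<close> plus an error of at most 1/(N+1).\<close>
    have D: "u m \<in> D N" "u n \<in> D N" using u anti that by blast+
    define j where "j = J (\<lambda>x. (1/2) *\<^sub>R (u m x + u n x))"
    have "(\<integral>x. gap m n x \<partial>M) = J (u m) + J (u n) - 2 * j"
      unfolding gap_def[abs_def] J_def j_def using ui' by (simp add: \<Phi>_int)
    moreover have "d N \<le> j"
      unfolding j_def by (intro d_le mid D)
    moreover have "J (u m) \<le> l + inverse (Suc m)" "J (u n) \<le> l + inverse (Suc n)"
      using u(2)[of m] u(2)[of n] dl[of m] dl[of n] by linarith+
    moreover have "inverse (real (Suc m)) \<le> inverse (real (Suc N))" "inverse (real (Suc n)) \<le> inverse (real (Suc N))"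
      using that by (auto simp: le_imp_inverse_le)
    ultimately show ?thesis by argo
  qed
  have "\<exists>N. \<forall>m\<ge>N. \<forall>n\<ge>N. (\<integral>x. norm (u m x - u n x) \<partial>M) < e" if e: "e > 0" for e
  proof -
    define R where "R = (\<integral>x. r x \<partial>M)"
    have R: "R \<ge> 0" unfolding R_def using r(2) by (intro integral_nonneg_AE) (auto intro: less_imp_le)
    obtain K N1 where K: "K \<ge> 0"
      and N1: "\<And>u. u \<in> D N1 \<Longrightarrow> (\<integral>x. max 0 (norm (u x) - K * r x) \<partial>M) \<le> e / 32"
      using ui[of "e / 32"] e by auto
    \<comment> \<open>The budget is e/4 for \<eta> R, less than e/4 for the convexity defect and e/8
      for each excess term. Using R + 1 keeps the denominator positive.\<close>
    define \<eta> where "\<eta> = e / 4 / (R + 1)"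
    have \<eta>: "\<eta> > 0" using e R by (simp add: \<eta>_def)
    have "\<eta> * R \<le> \<eta> * (R + 1)" using \<eta> by simp
    also have "\<dots> = e / 4" using R by (subst nonzero_eq_divide_eq[symmetric]) (auto simp: \<eta>_def)
    finally have \<eta>R: "\<eta> * R \<le> e / 4" .
    define c where "c = 4 * (1 + 2 * K) ^ 3 / \<eta>"
    have c: "c \<ge> 0" using K \<eta> by (simp add: c_def)
    have "(\<lambda>N. c * (2 * (l - d N) + 2 * inverse (Suc N))) \<longlonglongrightarrow> c * (2 * (l - l) + 2 * 0)"
      by (intro tendsto_intros l LIMSEQ_inverse_real_of_nat)
    then have "\<forall>\<^sub>F N in sequentially. c * (2 * (l - d N) + 2 * inverse (Suc N)) < e / 4"
      by (rule order_tendstoD) (use e in simp)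
    then obtain N2 where N2: "\<And>N. N \<ge> N2 \<Longrightarrow> c * (2 * (l - d N) + 2 * inverse (Suc N)) < e / 4"
      by (auto simp: eventually_sequentially)
    define N where "N = max N1 N2"
    have "(\<integral>x. norm (u m x - u n x) \<partial>M) < e" if "m \<ge> N" "n \<ge> N" for m n
    proof -
      have D1: "u m \<in> D N1" "u n \<in> D N1"
        using that u anti[of N1 m] anti[of N1 n] by (auto simp: N_def)
      have "(\<integral>x. norm (u m x - u n x) \<partial>M) \<le> (\<integral>x. \<eta> * r x + c * gap m n x
          + 4 * max 0 (norm (u m x) - K * r x) + 4 * max 0 (norm (u n x) - K * r x) \<partial>M)"
      proof (rule integral_mono)
        show "norm (u m x - u n x) \<le> \<eta> * r x + c * gap m n x
          + 4 * max 0 (norm (u m x) - K * r x) + 4 * max 0 (norm (u n x) - K * r x)" for x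
          using norm_diff_midpoint_gap[OF r(2) K \<eta>, of "u m x" "u n x" x]
          by (simp add: gap_def \<Phi>_def c_def)
      qed (use r ui' gap_int in auto)
      also have "\<dots> = \<eta> * R + c * (\<integral>x. gap m n x \<partial>M)
          + 4 * (\<integral>x. max 0 (norm (u m x) - K * r x) \<partial>M) + 4 * (\<integral>x. max 0 (norm (u n x) - K * r x) \<partial>M)"
        using r ui' gap_int by (simp add: R_def)
      also have "\<dots> \<le> e / 4 + c * (2 * (l - d N) + 2 * inverse (Suc N)) + 4 * (e / 32) + 4 * (e / 32)"
        using gap_bound[OF that] c by (intro add_mono \<eta>R mult_left_mono N1 D1) auto
      also have "\<dots> < e"
        using N2[of N] e by (simp add: N_def)
      finally show ?thesis .
    qed
    then show ?thesis by blast
  qed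
  from L1_Cauchy_imp_tendsto[OF ui' this] show ?thesis
    using u by blast
qed

subsection \<open>Relaxed slopes\<close>

text \<open>Measuring the excess over multiples of an integrable weight, not over constants, also
  excludes escape of mass to infinity, as the measure may be infinite.\<close>

lemma L1_weak_tendsto_uniformly_integrable:
  assumes r: "integrable M r" "\<And>x. r x > (0::real)"
    and nonneg: "\<And>n x. 0 \<le> gs n x"
    and weak: "L1_weak_tendsto M gs g" and e: "e > 0"
  shows "\<exists>K\<ge>0. \<exists>N. \<forall>n\<ge>N. (\<integral>x. max 0 (gs n x - K * r x) \<partial>M) \<le> e"
proof (rule ccontr)
  assume neg: "\<not> ?thesis"
  \<comment> \<open>The thresholds grow geometrically so that the weighted masses of the exceptional
    sets are summable.\<close>
  have "\<exists>n\<ge>j. (\<integral>x. max 0 (gs n x - 2 ^ j * r x) \<partial>M) > e" for j :: nat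
  proof (rule ccontr)
    assume "\<not> ?thesis"
    then have "\<forall>n\<ge>j. (\<integral>x. max 0 (gs n x - 2 ^ j * r x) \<partial>M) \<le> e"
      by (simp add: not_less)
    moreover have "(0::real) \<le> 2 ^ j" by simp
    ultimately show False using neg by blast
  qed
  then obtain k where k: "\<And>j. k j \<ge> j" "\<And>j. (\<integral>x. max 0 (gs (k j) x - 2 ^ j * r x) \<partial>M) > e"
    by metis
  have int: "integrable M (gs n)" "integrable M g" for n
    using weak by (auto simp: L1_weak_tendsto_def L1_def)
  have lim: "(\<lambda>n. \<integral>x. gs n x * h x \<partial>M) \<longlonglongrightarrow> (\<integral>x. g x * h x \<partial>M)" if "h \<in> Linfty M" for h
    using weak that by (auto simp: L1_weak_tendsto_def)
  have [measurable]: "gs n \<in> borel_measurable M" "r \<in> borel_measurable M" for n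
    using int r by simp_all
  have "(\<lambda>x. 1::real) \<in> Linfty M"
    by (auto simp: Linfty_def)
  from lim[OF this] have "Bseq (\<lambda>n. \<integral>x. gs n x \<partial>M)"
    by (intro convergent_imp_Bseq convergentI) simp
  then obtain C where C: "\<And>n. norm (\<integral>x. gs n x \<partial>M) \<le> C"
    by (auto simp: Bseq_def)
  define B where "B j = {x \<in> space M. 2 ^ j * r x < gs (k j) x}" for j
  have [measurable]: "B j \<in> sets M" for j
    unfolding B_def by measurable
  have int_B: "integrable M (\<lambda>x. r x * indicator (B j) x)" for j
    using integrable_mult_indicator[OF \<open>B j \<in> sets M\<close> r(1)] by (simp add: mult.commute)
  \<comment> \<open>Markov's inequality. The integrals of \<open>gs\<close> are bounded since
    testing weak convergence against 1 makes them converge.\<close>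
  have "(\<integral>x. r x * indicator (B j) x \<partial>M) \<le> C * (1 / 2) ^ j" for j
  proof -
    have "2 ^ j * (\<integral>x. r x * indicator (B j) x \<partial>M) = (\<integral>x. 2 ^ j * (r x * indicator (B j) x) \<partial>M)"
      by simp
    also have "\<dots> \<le> (\<integral>x. gs (k j) x \<partial>M)"
      using int int_B nonneg
      by (intro integral_mono integrable_mult_right) (auto simp: B_def split: split_indicator)
    also have "\<dots> \<le> C" using C[of "k j"] by simp
    finally show ?thesis by (simp add: field_simps power_divide)
  qed
  note B_le = this
  \<comment> \<open>Borel-Cantelli is applied to the weighted measure; positivity of
    \<open>r\<close> carries the conclusion back to \<open>M\<close>.\<close>
  let ?N = "density M (\<lambda>x. ennreal (r x))"
  have emeasure_B: "emeasure ?N (B j) = ennreal (\<integral>x. r x * indicator (B j) x \<partial>M)" for j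
  proof -
    have "emeasure ?N (B j) = (\<integral>\<^sup>+x. ennreal (r x * indicator (B j) x) \<partial>M)"
      by (subst emeasure_density) (auto intro!: nn_integral_cong split: split_indicator)
    also have "\<dots> = ennreal (\<integral>x. r x * indicator (B j) x \<partial>M)"
      using int_B r(2) by (intro nn_integral_eq_integral) (auto intro: less_imp_le split: split_indicator)
    finally show ?thesis .
  qed
  have int_B0: "0 \<le> (\<integral>x. r x * indicator (B j) x \<partial>M)" for j
    using r(2) by (intro integral_nonneg_AE) (auto intro: less_imp_le split: split_indicator)
  have "AE x in ?N. \<forall>\<^sub>F j in sequentially. x \<in> space ?N - B j"
  proof (rule borel_cantelli_AE1)
    show "B j \<in> sets ?N" for j by simp
    show "emeasure ?N (B j) < \<infinity>" for j by (simp add: emeasure_B)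
    have "measure ?N (B j) = (\<integral>x. r x * indicator (B j) x \<partial>M)" for j
      using int_B0 by (simp add: measure_def emeasure_B)
    then have "norm (measure ?N (B j)) \<le> C * (1 / 2) ^ j" for j
      using B_le[of j] int_B0[of j] by simp
    then show "summable (\<lambda>j. measure ?N (B j))"
    proof (rule summable_comparison_test'[where N = 0, rotated])
      show "summable (\<lambda>j. C * (1 / 2) ^ j)"
        by (intro summable_mult summable_geometric) simp
    qed
  qed
  then have ev: "AE x in M. \<forall>\<^sub>F j in sequentially. x \<notin> B j"
    using r(2) by (subst (asm) AE_density) (auto elim: eventually_mono)
  define E where "E n = (\<Union>j\<in>{n..}. B j)" for n
  have [measurable]: "E n \<in> sets M" for n
    unfolding E_def by (intro sets.countable_UN') auto
  have "(\<lambda>n. \<integral>x. g x * indicator (E n) x \<partial>M) \<longlonglongrightarrow> (\<integral>x. 0 \<partial>M)"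
  proof (rule integral_dominated_convergence[where w = "\<lambda>x. norm (g x)"])
    show "AE x in M. (\<lambda>n. g x * indicator (E n) x) \<longlonglongrightarrow> 0"
      using ev
    proof eventually_elim
      case (elim x)
      then obtain n0 where "\<And>j. j \<ge> n0 \<Longrightarrow> x \<notin> B j"
        by (auto simp: eventually_sequentially)
      then have "x \<notin> E n" if "n \<ge> n0" for n
        using that by (auto simp: E_def)
      then show ?case
        by (intro tendsto_eventually eventually_sequentiallyI[of n0]) auto
    qed
  qed (use int in \<open>auto split: split_indicator\<close>)
  \<comment> \<open>For j \<ge> n the whole excess of \<open>gs (k j)\<close> sits in B j, hence in
    E n. The set E n is fixed while j grows, so its indicator is an admissible test
    function.\<close>
  moreover have "e \<le> (\<integral>x. g x * indicator (E n) x \<partial>M)" for n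
  proof (rule tendsto_lowerbound)
    have "(\<lambda>x. indicator (E n) x :: real) \<in> Linfty M"
      unfolding Linfty_def by (auto intro!: exI[of _ 1] AE_I2 split: split_indicator)
    from lim[OF this] show "(\<lambda>j. \<integral>x. gs (k j) x * indicator (E n) x \<partial>M) \<longlonglongrightarrow> (\<integral>x. g x * indicator (E n) x \<partial>M)"
      by (rule filterlim_compose) (rule filterlim_at_top_mono[OF filterlim_ident], use k in auto)
    show "\<forall>\<^sub>F j in sequentially. e \<le> (\<integral>x. gs (k j) x * indicator (E n) x \<partial>M)"
    proof (rule eventually_sequentiallyI[of n])
      fix j assume "n \<le> j"
      have "e \<le> (\<integral>x. max 0 (gs (k j) x - 2 ^ j * r x) \<partial>M)" using k(2)[of j] by simp
      also have "\<dots> \<le> (\<integral>x. gs (k j) x * indicator (E n) x \<partial>M)"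
      proof (rule integral_mono)
        show "integrable M (\<lambda>x. gs (k j) x * indicator (E n) x)"
          using integrable_mult_indicator[OF \<open>E n \<in> sets M\<close> int(1)[of "k j"]] by (simp add: mult.commute)
        fix x assume x: "x \<in> space M"
        have "0 \<le> 2 ^ j * r x" using r(2)[of x] by simp
        moreover have "x \<in> E n" if "2 ^ j * r x < gs (k j) x"
          using that x \<open>n \<le> j\<close> by (auto simp: E_def B_def)
        ultimately show "max 0 (gs (k j) x - 2 ^ j * r x) \<le> gs (k j) x * indicator (E n) x"
          using nonneg[of "k j" x] by (cases "2 ^ j * r x < gs (k j) x") (auto split: split_indicator)
      qed (use int r in auto)
      finally show "e \<le> (\<integral>x. gs (k j) x * indicator (E n) x \<partial>M)" .
    qed
  qed simp
  ultimately have "e \<le> (\<integral>x. 0 \<partial>M)"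
    by (intro tendsto_lowerbound[where F = sequentially]) auto
  then show False using e by simp
qed

section \<open>Midpoint hulls, that is, dyadic convex combinations\<close>

inductive_set midpoint_hull :: "('a \<Rightarrow> real) set \<Rightarrow> ('a \<Rightarrow> real) set" for S where
  base: "f \<in> S \<Longrightarrow> f \<in> midpoint_hull S"
| midpoint: "f \<in> midpoint_hull S \<Longrightarrow> g \<in> midpoint_hull S \<Longrightarrow> (\<lambda>x. (f x + g x) / 2) \<in> midpoint_hull S"

lemma midpoint_hull_mono: "S \<subseteq> S' \<Longrightarrow> midpoint_hull S \<subseteq> midpoint_hull S'"
proof
  fix f assume "S \<subseteq> S'" "f \<in> midpoint_hull S"
  from this(2,1) show "f \<in> midpoint_hull S'"
    by induction (auto intro: midpoint_hull.intros)
qed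

lemma test_functions_midpoint:
  assumes "f \<in> test_functions" "g \<in> test_functions"
  shows "(\<lambda>x. (f x + g x) / 2) \<in> test_functions"
  using test_functions_scale[OF test_functions_add[OF assms], of "1/2"] by simp

lemma midpoint_hull_test_functions:
  assumes "S \<subseteq> test_functions" "f \<in> midpoint_hull S"
  shows "f \<in> test_functions"
  using assms(2,1)
proof induction
  case (midpoint f g)
  then show ?case by (simp add: test_functions_midpoint)
qed auto

text \<open>Sublevel sets of a midpoint-convex functional are closed under midpoints. It serves for
  the excess of the gradient over K r, for the L1 distance to \<open>f\<close>, and for the gradient
  norm integrated against a bounded weight.\<close>

lemma midpoint_hull_bound:
  assumes "S \<subseteq> test_functions" and "\<And>f. f \<in> S \<Longrightarrow> J f \<le> (e::real)"
    and mid: "\<And>f g. f \<in> test_functions \<Longrightarrow> g \<in> test_functions \<Longrightarrow>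
      J (\<lambda>x. (f x + g x) / 2) \<le> (J f + J g) / 2"
    and "f \<in> midpoint_hull S"
  shows "J f \<le> e"
  using assms(4)
proof induction
  case (midpoint f g)
  then have "J (\<lambda>x. (f x + g x) / 2) \<le> (J f + J g) / 2"
    by (intro mid midpoint_hull_test_functions[OF assms(1)])
  also have "(J f + J g) / 2 \<le> e"
    using midpoint.IH by simp
  finally show ?case .
qed (rule assms)

lemma norm_midpoint_le:
  fixes u v :: "'b::real_normed_vector"
  shows "norm ((1/2) *\<^sub>R (u + v)) \<le> (1/2) * (norm u + norm v)"
  using norm_triangle_ineq[of u v] by simp

section \<open>From weakly convergent slopes to a strongly convergent gradient\<close>

context radon begin

lemma L1_tendsto_norm:
  fixes u :: "'a \<Rightarrow> 'b::euclidean_space"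
  assumes "L1_tendsto \<mu> us u"
  shows "L1_tendsto \<mu> (\<lambda>n x. norm (us n x)) (\<lambda>x. norm (u x))"
proof -
  have i: "integrable \<mu> (us n)" "integrable \<mu> u" for n
    using assms by (auto simp: L1_tendsto_def L1_def)
  have l: "(\<lambda>n. \<integral>x. norm (us n x - u x) \<partial>\<mu>) \<longlonglongrightarrow> 0"
    using assms by (auto simp: L1_tendsto_def L1_def)
  have "(\<integral>x. norm (norm (us n x) - norm (u x)) \<partial>\<mu>) \<le> (\<integral>x. norm (us n x - u x) \<partial>\<mu>)" for n
    using i by (intro integral_mono) (auto simp: norm_triangle_ineq3)
  then have "norm (\<integral>x. norm (norm (us n x) - norm (u x)) \<partial>\<mu>) \<le> (\<integral>x. norm (us n x - u x) \<partial>\<mu>)" for n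
    by simp
  then have "(\<lambda>n. \<integral>x. norm (norm (us n x) - norm (u x)) \<partial>\<mu>) \<longlonglongrightarrow> 0"
    by (intro Lim_null_comparison[OF always_eventually l] allI)
  then show ?thesis using i by (simp add: L1_tendsto_def L1_def)
qed

lemma L1_tendsto_imp_weak:
  assumes "L1_tendsto \<mu> us u"
  shows "L1_weak_tendsto \<mu> us u"
  using assms L1_tendsto_inner_Linfty[OF assms]
  by (auto simp: L1_weak_tendsto_def L1_tendsto_def)

lemma tan_grad_mid:
  fixes T :: "'a \<Rightarrow> 'a set"
  assumes T: "is_bundle T" and "f \<in> test_functions" "g \<in> test_functions"
  shows "tan_grad T (\<lambda>x. (f x + g x) / 2) x = (1/2) *\<^sub>R (tan_grad T f x + tan_grad T g x)"
  using tan_grad_scale[OF T test_functions_add[OF assms(2,3)], of "1/2" x] tan_grad_add[OF T assms(2,3), of x]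
  by simp

lemma weak_slope_imp_sobolev_grad:
  fixes T :: "'a \<Rightarrow> 'a set"
  assumes T: "is_bundle T" and f: "f \<in> L1 \<mu>"
    and fs: "\<And>n. fs n \<in> test_functions" and lim: "L1_tendsto \<mu> fs f"
    and weak: "L1_weak_tendsto \<mu> (\<lambda>n x. norm (tan_grad T (fs n) x)) G"
  shows "\<exists>w. is_sobolev_grad \<mu> T f w \<and> (AE x in \<mu>. norm (w x) \<le> G x)"
proof -
  obtain r :: "'a \<Rightarrow> real" where r: "integrable \<mu> r" "\<And>x. r x > 0"
    using obtain_positive_integrable_function by metis
  \<comment> \<open>Hulls of tails: any selection from \<open>H n\<close> inherits those limiting
    properties of \<open>fs\<close> that are expressed by midpoint-convex functionals.\<close>
  define H where "H n = midpoint_hull (fs ` {n..})" for n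
  have S: "fs ` {n..} \<subseteq> test_functions" for n using fs by auto
  have H: "\<phi> \<in> test_functions" if "\<phi> \<in> H n" for \<phi> n
    using midpoint_hull_test_functions[OF S] that by (simp add: H_def)
  have H_anti: "H n \<subseteq> H m" if "m \<le> n" for m n
    unfolding H_def using that by (intro midpoint_hull_mono image_mono) auto
  have bound: "J \<phi> \<le> e" if "\<phi> \<in> H n" "\<And>k. k \<ge> n \<Longrightarrow> J (fs k) \<le> e"
    "\<And>f g. f \<in> test_functions \<Longrightarrow> g \<in> test_functions \<Longrightarrow>
      J (\<lambda>x. (f x + g x) / 2) \<le> (J f + J g) / 2"
    for J :: "('a \<Rightarrow> real) \<Rightarrow> real" and e \<phi> n
  proof (rule midpoint_hull_bound[OF S[of n], where J = J and f = \<phi>])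
    show "\<phi> \<in> midpoint_hull (fs ` {n..})" using that(1) by (simp add: H_def)
  qed (use that(2,3) in auto)
  note ig = integrable_tan_grad[OF T]
  have fi: "integrable \<mu> f" using f by (simp add: L1_def)
  have ti: "integrable \<mu> \<phi>" if "\<phi> \<in> test_functions" for \<phi>
    using that by (intro integrable_compact_support test_functions_D)
  have "\<exists>u w. (\<forall>n. u n \<in> tan_grad T ` H n) \<and> L1_tendsto \<mu> u w"
  proof (rule L1_convergent_selection[OF r])
    show "tan_grad T ` H n \<subseteq> tan_grad T ` H m" if "m \<le> n" for m n
      using H_anti[OF that] by blast
    show "tan_grad T ` H n \<noteq> {}" for n
      unfolding H_def using midpoint_hull.base[of "fs n" "fs ` {n..}"] by auto
    show "integrable \<mu> u" if "u \<in> tan_grad T ` H n" for n u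
      using that H ig by blast
    show "(\<lambda>x. (1/2) *\<^sub>R (u x + v x)) \<in> tan_grad T ` H n"
      if uv: "u \<in> tan_grad T ` H n" "v \<in> tan_grad T ` H n" for n u v
    proof -
      obtain \<phi> \<psi> where "\<phi> \<in> H n" "\<psi> \<in> H n" "u = tan_grad T \<phi>" "v = tan_grad T \<psi>"
        using uv by blast
      moreover from this have "(\<lambda>x. (\<phi> x + \<psi> x) / 2) \<in> H n"
        unfolding H_def by (intro midpoint_hull.midpoint)
      ultimately show ?thesis
        using H by (intro image_eqI[where x = "\<lambda>x. (\<phi> x + \<psi> x) / 2"]) (auto simp: tan_grad_mid[OF T])
    qed
    fix e :: real assume "e > 0"
    from L1_weak_tendsto_uniformly_integrable[OF r _ weak this]
    obtain K N where K: "K \<ge> 0"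
      and N: "\<And>n. n \<ge> N \<Longrightarrow> (\<integral>x. max 0 (norm (tan_grad T (fs n) x) - K * r x) \<partial>\<mu>) \<le> e"
      by auto
    \<comment> \<open>Uniform integrability is known along the tail of \<open>fs\<close> only. The
      tangential gradient is linear in the potential and the excess is convex in the gradient, so
      the bound extends to the hull.\<close>
    have "(\<integral>x. max 0 (norm (tan_grad T \<phi> x) - K * r x) \<partial>\<mu>) \<le> e" if "\<phi> \<in> H N" for \<phi>
    proof (rule bound[where J = "\<lambda>\<phi>. \<integral>x. max 0 (norm (tan_grad T \<phi> x) - K * r x) \<partial>\<mu>", OF that N])
      fix f g :: "'a \<Rightarrow> real" assume fg: "f \<in> test_functions" "g \<in> test_functions"
      have "(\<integral>x. max 0 (norm (tan_grad T (\<lambda>x. (f x + g x) / 2) x) - K * r x) \<partial>\<mu>)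
        \<le> (\<integral>x. (max 0 (norm (tan_grad T f x) - K * r x) + max 0 (norm (tan_grad T g x) - K * r x)) / 2 \<partial>\<mu>)"
      proof (rule integral_mono)
        show "integrable \<mu> (\<lambda>x. max 0 (norm (tan_grad T (\<lambda>x. (f x + g x) / 2) x) - K * r x))"
          using r fg by (intro Bochner_Integration.integrable_max Bochner_Integration.integrable_diff
              integrable_norm ig test_functions_midpoint) auto
        show "max 0 (norm (tan_grad T (\<lambda>x. (f x + g x) / 2) x) - K * r x)
          \<le> (max 0 (norm (tan_grad T f x) - K * r x) + max 0 (norm (tan_grad T g x) - K * r x)) / 2" for x
          unfolding tan_grad_mid[OF T fg] using norm_midpoint_le[of "tan_grad T f x" "tan_grad T g x"]
          by (simp add: max_def)
      qed (use r ig fg in auto)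
      also have "\<dots> = ((\<integral>x. max 0 (norm (tan_grad T f x) - K * r x) \<partial>\<mu>)
          + (\<integral>x. max 0 (norm (tan_grad T g x) - K * r x) \<partial>\<mu>)) / 2"
        using r ig fg by simp
      finally show "(\<integral>x. max 0 (norm (tan_grad T (\<lambda>x. (f x + g x) / 2) x) - K * r x) \<partial>\<mu>)
        \<le> ((\<integral>x. max 0 (norm (tan_grad T f x) - K * r x) \<partial>\<mu>)
          + (\<integral>x. max 0 (norm (tan_grad T g x) - K * r x) \<partial>\<mu>)) / 2" .
    qed
    then show "\<exists>K\<ge>0. \<exists>N. \<forall>u\<in>tan_grad T ` H N. (\<integral>x. max 0 (norm (u x) - K * r x) \<partial>\<mu>) \<le> e"
      using K by blast
  qed
  then obtain u w where u: "\<And>n. u n \<in> tan_grad T ` H n" and uw: "L1_tendsto \<mu> u w"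
    by blast
  then have "\<forall>n. \<exists>\<phi>. \<phi> \<in> H n \<and> u n = tan_grad T \<phi>"
    by blast
  then obtain \<phi> where \<phi>: "\<And>n. \<phi> n \<in> H n" and u_eq: "\<And>n. u n = tan_grad T (\<phi> n)"
    by (auto dest!: choice)
  have \<phi>w: "L1_tendsto \<mu> (\<lambda>n. tan_grad T (\<phi> n)) w"
    using uw u_eq by (simp add: L1_tendsto_def)
  have \<phi>f: "L1_tendsto \<mu> \<phi> f"
  proof -
    \<comment> \<open>The potentials converge as well: the L1 distance to \<open>f\<close> is
      convex, so on the hull of a tail it obeys every upper bound valid on that tail.\<close>
    have "(\<lambda>n. \<integral>x. norm (\<phi> n x - f x) \<partial>\<mu>) \<longlonglongrightarrow> 0"
    proof (rule LIMSEQ_I)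
      fix e :: real assume "e > 0"
      have "(\<lambda>n. \<integral>x. norm (fs n x - f x) \<partial>\<mu>) \<longlonglongrightarrow> 0"
        using lim by (simp add: L1_tendsto_def)
      then have "\<forall>\<^sub>F n in sequentially. (\<integral>x. norm (fs n x - f x) \<partial>\<mu>) < e / 2"
        by (rule order_tendstoD) (use \<open>e > 0\<close> in simp)
      then obtain N where N: "\<And>n. n \<ge> N \<Longrightarrow> (\<integral>x. norm (fs n x - f x) \<partial>\<mu>) < e / 2"
        by (auto simp: eventually_sequentially)
      have "(\<integral>x. norm (\<phi> n x - f x) \<partial>\<mu>) \<le> e / 2" if "n \<ge> N" for n
      proof (rule bound[where J = "\<lambda>\<phi>. \<integral>x. norm (\<phi> x - f x) \<partial>\<mu>", OF \<phi>])
        show "(\<integral>x. norm (fs k x - f x) \<partial>\<mu>) \<le> e / 2" if "k \<ge> n" for k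
          using N[of k] that \<open>n \<ge> N\<close> by simp
        fix g h :: "'a \<Rightarrow> real" assume gh: "g \<in> test_functions" "h \<in> test_functions"
        have "(\<integral>x. norm ((g x + h x) / 2 - f x) \<partial>\<mu>)
          \<le> (\<integral>x. (norm (g x - f x) + norm (h x - f x)) / 2 \<partial>\<mu>)"
        proof (rule integral_mono)
          show "norm ((g x + h x) / 2 - f x) \<le> (norm (g x - f x) + norm (h x - f x)) / 2" for x
            by (simp add: abs_if field_simps)
        qed (use fi ti[OF gh(1)] ti[OF gh(2)] in auto)
        also have "\<dots> = ((\<integral>x. norm (g x - f x) \<partial>\<mu>) + (\<integral>x. norm (h x - f x) \<partial>\<mu>)) / 2"
          using fi ti[OF gh(1)] ti[OF gh(2)] by simp
        finally show "(\<integral>x. norm ((g x + h x) / 2 - f x) \<partial>\<mu>)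
          \<le> ((\<integral>x. norm (g x - f x) \<partial>\<mu>) + (\<integral>x. norm (h x - f x) \<partial>\<mu>)) / 2" .
      qed
      then have "norm ((\<integral>x. norm (\<phi> n x - f x) \<partial>\<mu>) - 0) < e" if "n \<ge> N" for n
        using that \<open>e > 0\<close> by (force intro: le_less_trans)
      then show "\<exists>N. \<forall>n\<ge>N. norm ((\<integral>x. norm (\<phi> n x - f x) \<partial>\<mu>) - 0) < e"
        by blast
    qed
    then show ?thesis
      using f ti[OF H[OF \<phi>]] by (simp add: L1_tendsto_def L1_def)
  qed
  have wi: "integrable \<mu> w" using \<phi>w by (simp add: L1_tendsto_def L1_def)
  have "AE x in \<mu>. w x \<in> T x"
    by (rule AE_mem_subspace_L1_limit[OF T \<phi>w]) (simp add: tan_grad_def orth_proj_mem[OF subspace_T[OF T]])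
  then have "is_sobolev_grad \<mu> T f w"
    unfolding is_sobolev_grad_def Gamma1_def using wi H[OF \<phi>] \<phi>f \<phi>w by (auto simp: L1_def)
  moreover have "AE x in \<mu>. norm (w x) \<le> G x"
  proof -
    have Gi: "integrable \<mu> G" using weak by (simp add: L1_weak_tendsto_def L1_def)
    have [measurable]: "G \<in> borel_measurable borel" "w \<in> borel_measurable borel"
      using borel_measurable_integrable[OF Gi] borel_measurable_integrable[OF wi] by simp_all
    \<comment> \<open>The indicator of the set where the claimed inequality fails; comparing
      integrals against it shows that this set is null.\<close>
    define h :: "'a \<Rightarrow> real" where "h = indicator {x. G x < norm (w x)}"
    have h0: "0 \<le> h x" for x by (simp add: h_def)
    have hL: "h \<in> Linfty \<mu>"
      unfolding Linfty_def h_def by (auto intro!: exI[of _ 1] AE_I2 split: split_indicator)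
    have mh: "integrable \<mu> (\<lambda>x. a x * h x)" if "integrable \<mu> a" for a :: "'a \<Rightarrow> real"
      using integrable_mult_Linfty[OF that hL] by simp
    have "(\<integral>x. norm (w x) * h x \<partial>\<mu>) \<le> (\<integral>x. G x * h x \<partial>\<mu>)"
    proof (rule field_le_epsilon)
      fix e :: real assume "e > 0"
      have "(\<lambda>n. \<integral>x. norm (tan_grad T (fs n) x) * h x \<partial>\<mu>) \<longlonglongrightarrow> (\<integral>x. G x * h x \<partial>\<mu>)"
        using weak hL by (simp add: L1_weak_tendsto_def)
      then have "\<forall>\<^sub>F n in sequentially. (\<integral>x. norm (tan_grad T (fs n) x) * h x \<partial>\<mu>) < (\<integral>x. G x * h x \<partial>\<mu>) + e"
        by (rule order_tendstoD) (use \<open>e > 0\<close> in simp)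
      then obtain N where N: "\<And>n. n \<ge> N \<Longrightarrow> (\<integral>x. norm (tan_grad T (fs n) x) * h x \<partial>\<mu>) < (\<integral>x. G x * h x \<partial>\<mu>) + e"
        by (auto simp: eventually_sequentially)
      show "(\<integral>x. norm (w x) * h x \<partial>\<mu>) \<le> (\<integral>x. G x * h x \<partial>\<mu>) + e"
      \<comment> \<open>Weak convergence bounds the weighted slopes on a tail, convexity extends
        this bound to its hull, and strong convergence passes it on to \<open>w\<close>.\<close>
      proof (rule tendsto_upperbound)
        show "(\<lambda>n. \<integral>x. norm (tan_grad T (\<phi> n) x) * h x \<partial>\<mu>) \<longlonglongrightarrow> (\<integral>x. norm (w x) * h x \<partial>\<mu>)"
          using L1_tendsto_inner_Linfty[OF L1_tendsto_norm[OF \<phi>w] hL] by simp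
        have "(\<integral>x. norm (tan_grad T (\<phi> n) x) * h x \<partial>\<mu>) \<le> (\<integral>x. G x * h x \<partial>\<mu>) + e" if "n \<ge> N" for n
        proof (rule bound[where J = "\<lambda>\<phi>. \<integral>x. norm (tan_grad T \<phi> x) * h x \<partial>\<mu>", OF \<phi>])
          show "(\<integral>x. norm (tan_grad T (fs k) x) * h x \<partial>\<mu>) \<le> (\<integral>x. G x * h x \<partial>\<mu>) + e" if "k \<ge> n" for k
            using N[of k] that \<open>n \<ge> N\<close> by simp
          fix f g :: "'a \<Rightarrow> real" assume fg: "f \<in> test_functions" "g \<in> test_functions"
          have "(\<integral>x. norm (tan_grad T (\<lambda>x. (f x + g x) / 2) x) * h x \<partial>\<mu>)
            \<le> (\<integral>x. (norm (tan_grad T f x) * h x + norm (tan_grad T g x) * h x) / 2 \<partial>\<mu>)"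
          proof (rule integral_mono)
            show "integrable \<mu> (\<lambda>x. norm (tan_grad T (\<lambda>x. (f x + g x) / 2) x) * h x)"
              by (intro mh integrable_norm ig test_functions_midpoint fg)
            show "norm (tan_grad T (\<lambda>x. (f x + g x) / 2) x) * h x
              \<le> (norm (tan_grad T f x) * h x + norm (tan_grad T g x) * h x) / 2" for x
              unfolding tan_grad_mid[OF T fg]
              using mult_right_mono[OF norm_midpoint_le[of "tan_grad T f x" "tan_grad T g x"] h0[of x]]
              by (simp add: algebra_simps)
          qed (use mh ig fg in auto)
          also have "\<dots> = ((\<integral>x. norm (tan_grad T f x) * h x \<partial>\<mu>)
              + (\<integral>x. norm (tan_grad T g x) * h x \<partial>\<mu>)) / 2"
            using mh ig fg by simp
          finally show "(\<integral>x. norm (tan_grad T (\<lambda>x. (f x + g x) / 2) x) * h x \<partial>\<mu>)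
            \<le> ((\<integral>x. norm (tan_grad T f x) * h x \<partial>\<mu>) + (\<integral>x. norm (tan_grad T g x) * h x \<partial>\<mu>)) / 2" .
        qed
        then show "\<forall>\<^sub>F n in sequentially. (\<integral>x. norm (tan_grad T (\<phi> n) x) * h x \<partial>\<mu>) \<le> (\<integral>x. G x * h x \<partial>\<mu>) + e"
          by (rule eventually_sequentiallyI)
      qed simp
    qed
    moreover have i: "integrable \<mu> (\<lambda>x. norm (w x) * h x - G x * h x)"
      using mh[OF Gi] mh[OF integrable_norm[OF wi]] by simp
    moreover have nn: "0 \<le> norm (w x) * h x - G x * h x" for x
      by (simp add: h_def split: split_indicator)
    moreover have "(\<integral>x. norm (w x) * h x - G x * h x \<partial>\<mu>) = (\<integral>x. norm (w x) * h x \<partial>\<mu>) - (\<integral>x. G x * h x \<partial>\<mu>)"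
      using mh[OF Gi] mh[OF integrable_norm[OF wi]] by simp
    moreover have "0 \<le> (\<integral>x. norm (w x) * h x - G x * h x \<partial>\<mu>)"
      using nn by (intro integral_nonneg_AE) simp
    ultimately have "(\<integral>x. norm (w x) * h x - G x * h x \<partial>\<mu>) = 0"
      by linarith
    then have "AE x in \<mu>. norm (w x) * h x - G x * h x = 0"
      using integral_nonneg_eq_0_iff_AE[OF i AE_I2[OF nn]] by blast
    then show ?thesis
      by eventually_elim (auto simp: h_def split: split_indicator_asm)
  qed
  ultimately show ?thesis by blast
qed

end

section \<open>Sobolev functions characterized by relaxed slopes\<close>

theorem theorem4p13:
  fixes \<mu> :: "'a::euclidean_space measure"
    and T :: "'a \<Rightarrow> 'a set"
    and f :: "'a \<Rightarrow> real"
  assumes "radon_measure \<mu>"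
    and "is_tangent_bundle \<mu> T"
    and "f \<in> L1 \<mu>"
  shows "(f \<in> W11 \<mu> T \<longleftrightarrow> TRS \<mu> T f \<noteq> {}) \<and>
    (f \<in> W11 \<mu> T \<longrightarrow>
      (\<forall>w. is_sobolev_grad \<mu> T f w \<longrightarrow> is_minimal_TRS \<mu> T f (\<lambda>x. norm (w x))))"
proof -
  interpret radon \<mu> by unfold_locales fact
  have T: "is_bundle T"
    using assms(2) by (simp add: is_tangent_bundle_def)
  \<comment> \<open>Norms of strongly converging gradients converge strongly, hence weakly, so one
    sequence witnesses both notions.\<close>
  have slope: "(\<lambda>x. norm (w x)) \<in> TRS \<mu> T f" if w: "is_sobolev_grad \<mu> T f w" for w
  proof -
    obtain fs where fs: "\<And>n. fs n \<in> test_functions" "L1_tendsto \<mu> fs f"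
      and gr: "L1_tendsto \<mu> (\<lambda>n. tan_grad T (fs n)) w"
      using w by (auto simp: is_sobolev_grad_def)
    have "L1_weak_tendsto \<mu> (\<lambda>n x. norm (tan_grad T (fs n) x)) (\<lambda>x. norm (w x))"
      by (intro L1_tendsto_imp_weak L1_tendsto_norm gr)
    then show ?thesis
      unfolding TRS_def using fs by (fastforce simp: L1_weak_tendsto_def)
  qed
  have grad: "\<exists>w. is_sobolev_grad \<mu> T f w \<and> (AE x in \<mu>. norm (w x) \<le> G x)" if G: "G \<in> TRS \<mu> T f" for G
  proof -
    obtain fs G' where "\<And>n. fs n \<in> test_functions" "L1_tendsto \<mu> fs f"
      "L1_weak_tendsto \<mu> (\<lambda>n x. norm (tan_grad T (fs n) x)) G'" and le: "AE x in \<mu>. G' x \<le> G x"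
      using G by (auto simp: TRS_def)
    then obtain w where w: "is_sobolev_grad \<mu> T f w" "AE x in \<mu>. norm (w x) \<le> G' x"
      using weak_slope_imp_sobolev_grad[OF T assms(3)] by blast
    from w(2) le have "AE x in \<mu>. norm (w x) \<le> G x"
      by eventually_elim simp
    with w(1) show ?thesis by blast
  qed
  have "f \<in> W11 \<mu> T \<longleftrightarrow> TRS \<mu> T f \<noteq> {}"
    using slope grad assms(3) unfolding W11_def by blast
  moreover have "is_minimal_TRS \<mu> T f (\<lambda>x. norm (w x))" if w: "is_sobolev_grad \<mu> T f w" for w
    unfolding is_minimal_TRS_def
  proof (intro conjI ballI slope w)
    fix G assume "G \<in> TRS \<mu> T f"
    \<comment> \<open>The gradient obtained from \<open>G\<close> may come from another sequence,
      but uniqueness identifies it with \<open>w\<close> almost everywhere.\<close>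
    then obtain w' where w': "is_sobolev_grad \<mu> T f w'" and le: "AE x in \<mu>. norm (w' x) \<le> G x"
      using grad by blast
    from sobolev_grad_unique[OF assms(2) w w'] le
    show "AE x in \<mu>. norm (w x) \<le> G x"
      by eventually_elim simp
  qed
  ultimately show ?thesis by blast
qed

end
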